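(* Let $2\leq m\leq n$ be integers. If $\tau>\frac{m}{m-1}-1$, then \[ \dim(W_0(m,n;\tau))=(m-1)n+\frac{m}{\tau+1}, \] and if $0<\tau\leq\frac{m}{m-1}-1$, then \[ \dim(W_0(m,n;\tau))=(m-1)(n+1). \]
   Context: $\mathbb{I}^{mn}:=[-\tfrac12,\tfrac12]^{mn}$, and its points are regarded as $m\times n$ matrices $X$. For a vector, $|\cdot|$ denotes the supremum norm; for $\mathbf{q}\in\mathbb{Z}^m$ (a row vector), $\mathbf{q}X\in\mathbb{R}^n$ is the vector-matrix product. For $\tau>0$ define \[ W_0(m,n;\tau):=\{X\in\mathbb{I}^{mn}: |\mathbf{q}X|<|\mathbf{q}|^{-\tau}\text{ for infinitely many }\mathbf{q}\in\mathbb{Z}^m\setminus\{\mathbf{0}\}\}. \] $\dim$ denotes Hausdorff dimension. *)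

theory Defs
  imports "HOL-Analysis.Analysis"
begin

(* The case s = 0 is separate because 0 powr 0 = 0 in the library, whereas a nonempty set
   must weigh 1 (so that the 0-dimensional measure is the counting measure). *)
definition hausdorff_weight :: "real \<Rightarrow> 'a::metric_space set \<Rightarrow> ennreal" where
  "hausdorff_weight s U =
     (if U = {} then 0 else if s = 0 then 1 else ennreal (diameter U powr s))"

(* Boundedness is explicit because the library's diameter is unspecified on unbounded sets. *)
definition delta_covers :: "real \<Rightarrow> 'a::metric_space set \<Rightarrow> (nat \<Rightarrow> 'a set) set" where
  "delta_covers \<delta> E =
     {U. E \<subseteq> (\<Union>i. U i) \<and> (\<forall>i. bounded (U i) \<and> diameter (U i) \<le> \<delta>)}"

definition hausdorff_premeasure :: "real \<Rightarrow> real \<Rightarrow> 'a::metric_space set \<Rightarrow> ennreal" where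
  "hausdorff_premeasure s \<delta> E = (INF U \<in> delta_covers \<delta> E. \<Sum>i. hausdorff_weight s (U i))"

definition hausdorff_measure :: "real \<Rightarrow> 'a::metric_space set \<Rightarrow> ennreal" where
  "hausdorff_measure s E = (SUP \<delta> \<in> {0<..}. hausdorff_premeasure s \<delta> E)"

definition hausdorff_dim :: "'a::metric_space set \<Rightarrow> ereal" where
  "hausdorff_dim E = (INF s \<in> {s. 0 \<le> s \<and> hausdorff_measure s E = 0}. ereal s)"

definition int_vec :: "int ^ 'm \<Rightarrow> real ^ 'm" where
  "int_vec q = (\<chi> i. real_of_int (q $ i))"

(* An m-by-n matrix has type real ^ 'n ^ 'm with m = CARD('m) and n = CARD('n); this space
   carries the Euclidean metric of R^(mn). The supremum norm on vectors is infnorm. *)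
definition unit_cube_matrices :: "(real ^ 'n ^ 'm) set" where
  "unit_cube_matrices = {X. \<forall>i j. X $ i $ j \<in> {-1/2..1/2}}"

definition W0 :: "real \<Rightarrow> (real ^ 'n ^ 'm) set" where
  "W0 \<tau> = {X \<in> unit_cube_matrices.
     infinite {q :: int ^ 'm. q \<noteq> 0 \<and>
       infnorm (int_vec q v* X) < infnorm (int_vec q) powr (-\<tau>)}}"

end

theory Submission
  imports Defs "HOL-Real_Asymp.Real_Asymp"
begin

text \<open>A matrix of rank \<open>m\<close> stretches every integer row vector by at least a constant factor, so for
\<open>m \<le> n\<close> the set \<open>W0 \<tau>\<close> consists of matrices with a nontrivial left kernel. A typical matrix of this
kind is given by the direction of its kernel, which has \<open>m - 1\<close> parameters, and by \<open>m - 1\<close> rows in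
\<open>\<real>\<^sup>n\<close> that may be chosen freely; the last row is then forced. It lies in \<open>W0 \<tau>\<close> when infinitely
many rational directions \<open>q / |q|\<close> approximate the kernel direction to within about
\<open>|q|\<close> to the power \<open>- (\<tau> + 1)\<close>. By Dirichlet's theorem every direction has this property
up to the threshold \<open>\<tau> = 1 / (m - 1) = m / (m - 1) - 1\<close>; beyond it the directions that do form, by the
theorem of Jarnik and Besicovitch, a set of dimension \<open>m / (\<tau> + 1)\<close>. Adding the \<open>(m - 1) n\<close> free
parameters gives both formulas.

For the upper bounds, the matrices \<open>X\<close> of the unit cube for which \<open>wX\<close> is small, where \<open>|w| = N\<close>, form a
slab that is thin in \<open>n\<close> directions, and there are about \<open>N\<close> to the power \<open>m - 1\<close> integer vectors
\<open>w\<close> of norm \<open>N\<close>. Covering \<open>W0 \<tau>\<close> by the slabs of all large norms gives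
\<open>(m - 1) n + m / (\<tau> + 1)\<close> (\<open>W0_null_by_shell_series\<close>). Since a vector \<open>q\<close> with \<open>qX\<close> small can be
scaled down to norm \<open>N\<close> and rounded, the slabs of one single norm already cover \<open>W0 \<tau>\<close>, and this gives
\<open>(m - 1) (n + 1)\<close> (\<open>W0_null_by_single_shell\<close>).

For the lower bounds it is enough to treat \<open>\<tau> > 1 / (m - 1)\<close>, because \<open>W0 \<tau>\<close> decreases with \<open>\<tau>\<close> and the
formula for large \<open>\<tau>\<close> tends to \<open>(m - 1) (n + 1)\<close> at the threshold. Counting the grid points that
Dirichlet's theorem attaches to each rational point shows that every cube contains many
well separated rational points with denominators near any prescribed large bound
(\<open>many_separated_rationals\<close>). Iterating this with rapidly increasing bounds yields a Cantor set of
well approximable points together with a sharp count of the points of each stage in small cubes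
(\<open>Cantor_set_of_well_approximable_points\<close>). The points of a stage, read as kernel directions, are combined
with the points of a fine grid of free rows. The resulting matrix depends on direction and rows through an
injection with Lipschitz inverse (\<open>kernel_matrix_inverse_Lipschitz\<close>), so the counts multiply, and a mass
distribution principle for finite sets (\<open>hausdorff_measure_nonzero_if_discrete_mass\<close>) bounds the
Hausdorff measure from below without constructing a limit measure.\<close>

section \<open>Hausdorff premeasures and dimension\<close>

lemma hausdorff_premeasure_le:
  assumes "U \<in> delta_covers \<delta> E"
  shows "hausdorff_premeasure s \<delta> E \<le> (\<Sum>i. hausdorff_weight s (U i))"
  unfolding hausdorff_premeasure_def by (rule INF_lower[OF assms])

lemma hausdorff_premeasure_mono:
  "E \<subseteq> F \<Longrightarrow> hausdorff_premeasure s \<delta> E \<le> hausdorff_premeasure s \<delta> F"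
  unfolding hausdorff_premeasure_def delta_covers_def
  by (rule INF_superset_mono) auto

lemma hausdorff_premeasure_single:
  assumes "bounded U" "diameter U \<le> \<delta>"
  shows "hausdorff_premeasure s \<delta> U \<le> hausdorff_weight s U"
proof -
  define V where "V = (\<lambda>i::nat. if i = 0 then U else {})"
  have "0 \<le> \<delta>" using assms diameter_ge_0 by force
  then have "V \<in> delta_covers \<delta> U"
    using assms by (auto simp: delta_covers_def V_def)
  then have "hausdorff_premeasure s \<delta> U \<le> (\<Sum>i. hausdorff_weight s (V i))"
    by (rule hausdorff_premeasure_le)
  also have "\<dots> = (\<Sum>i\<in>{0}. hausdorff_weight s (V i))"
    by (rule suminf_finite) (auto simp: V_def hausdorff_weight_def)
  finally show ?thesis by (simp add: V_def)
qed

text \<open>Countable subadditivity: near-optimal covers of the pieces, with errors summing to \<open>e\<close>, are merged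
into one sequence by pairing indices.\<close>

lemma hausdorff_premeasure_UN_le:
  "hausdorff_premeasure s \<delta> (\<Union>i::nat. A i) \<le> (\<Sum>i. hausdorff_premeasure s \<delta> (A i))"
proof (rule ennreal_le_epsilon)
  fix e :: real
  assume e: "0 < e" and fin: "(\<Sum>i. hausdorff_premeasure s \<delta> (A i)) < top"
  have "\<exists>U\<in>delta_covers \<delta> (A i). (\<Sum>j. hausdorff_weight s (U j)) < hausdorff_premeasure s \<delta> (A i) + ennreal (e * (1/2) ^ Suc i)" for i
  proof -
    have "hausdorff_premeasure s \<delta> (A i) < top"
      using fin ennreal_suminf_lessD by blast
    then have "hausdorff_premeasure s \<delta> (A i) < hausdorff_premeasure s \<delta> (A i) + ennreal (e * (1/2) ^ Suc i)"
      using e by (cases "hausdorff_premeasure s \<delta> (A i)") (auto simp flip: ennreal_plus simp: ennreal_less_iff)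
    then show ?thesis
      by (subst (asm) (1) hausdorff_premeasure_def) (simp add: INF_less_iff)
  qed
  then obtain U where U: "\<And>i. U i \<in> delta_covers \<delta> (A i)"
    and Us: "\<And>i. (\<Sum>j. hausdorff_weight s (U i j)) < hausdorff_premeasure s \<delta> (A i) + ennreal (e * (1/2) ^ Suc i)"
    by metis
  define V where "V = (\<lambda>n. case prod_decode n of (i, j) \<Rightarrow> U i j)"
  have "V \<in> delta_covers \<delta> (\<Union>i. A i)"
  proof -
    have "x \<in> (\<Union>n. V n)" if xA: "x \<in> A i" for x i
    proof -
      have "A i \<subseteq> (\<Union>j. U i j)" using U[of i] by (simp add: delta_covers_def)
      then obtain j where "x \<in> U i j" using xA by blast
      then have "x \<in> V (prod_encode (i, j))" by (simp add: V_def)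
      then show ?thesis by blast
    qed
    moreover have "bounded (V n) \<and> diameter (V n) \<le> \<delta>" for n
      using U by (auto simp: V_def delta_covers_def split: prod.split)
    ultimately show ?thesis by (auto simp: delta_covers_def)
  qed
  then have "hausdorff_premeasure s \<delta> (\<Union>i. A i) \<le> (\<Sum>n. hausdorff_weight s (V n))"
    by (rule hausdorff_premeasure_le)
  also have "\<dots> = (\<Sum>n. (case prod_decode n of (i, j) \<Rightarrow> hausdorff_weight s (U i j)))"
    by (simp add: V_def split_def)
  also have "\<dots> = (\<Sum>i. \<Sum>j. hausdorff_weight s (U i j))"
    by (subst suminf_ennreal_2dimen[of "\<lambda>i. \<Sum>j. hausdorff_weight s (U i j)" "\<lambda>(i, j). hausdorff_weight s (U i j)"])
       (auto simp: comp_def split_def)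
  also have "\<dots> \<le> (\<Sum>i. hausdorff_premeasure s \<delta> (A i) + ennreal (e * (1/2) ^ Suc i))"
    by (intro suminf_le) (use Us less_imp_le in auto)
  also have "\<dots> = (\<Sum>i. hausdorff_premeasure s \<delta> (A i)) + (\<Sum>i. ennreal (e * (1/2) ^ Suc i))"
    by (intro suminf_add[symmetric]) auto
  also have "(\<Sum>i. ennreal (e * (1/2) ^ Suc i)) = ennreal e"
    using sums_mult[OF power_half_series, of e] e by (intro suminf_ennreal_eq) auto
  finally show "hausdorff_premeasure s \<delta> (\<Union>i. A i) \<le> (\<Sum>i. hausdorff_premeasure s \<delta> (A i)) + ennreal e" .
qed

lemma hausdorff_premeasure_finite_UN_le:
  fixes A :: "'i \<Rightarrow> 'a::metric_space set"
  assumes "finite I" "0 \<le> \<delta>"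
  shows "hausdorff_premeasure s \<delta> (\<Union>i\<in>I. A i) \<le> (\<Sum>i\<in>I. hausdorff_premeasure s \<delta> (A i))"
proof -
  have empty: "hausdorff_premeasure s \<delta> ({} :: 'a set) = 0"
    using hausdorff_premeasure_single[of "{} :: 'a set" \<delta> s] assms(2)
    by (simp add: hausdorff_weight_def)
  obtain h where h: "bij_betw h {..<card I} I"
    using assms(1) by (metis atLeast0LessThan ex_bij_betw_nat_finite)
  let ?B = "\<lambda>k. if k < card I then A (h k) else {}"
  have "(\<Union>i\<in>I. A i) = (\<Union>k. ?B k)"
  proof (intro equalityI subsetI)
    fix x assume "x \<in> (\<Union>i\<in>I. A i)"
    then obtain i where "i \<in> I" "x \<in> A i" by blast
    then obtain k where "k < card I" "x \<in> A (h k)"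
      using bij_betw_imp_surj_on[OF h] by (metis imageE lessThan_iff)
    then have "x \<in> ?B k" by simp
    then show "x \<in> (\<Union>k. ?B k)" by blast
  qed (use h in \<open>auto simp: bij_betw_def split: if_splits\<close>)
  then have "hausdorff_premeasure s \<delta> (\<Union>i\<in>I. A i) \<le> (\<Sum>k. hausdorff_premeasure s \<delta> (?B k))"
    using hausdorff_premeasure_UN_le[of s \<delta> ?B] by simp
  also have "\<dots> = (\<Sum>k<card I. hausdorff_premeasure s \<delta> (?B k))"
    by (rule suminf_finite) (auto simp: empty)
  also have "\<dots> = (\<Sum>i\<in>I. hausdorff_premeasure s \<delta> (A i))"
    by (subst sum.reindex_bij_betw[OF h, symmetric]) simp
  finally show ?thesis .
qed

lemma hausdorff_measure_eq_0_iff: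
  "hausdorff_measure s E = 0 \<longleftrightarrow> (\<forall>\<delta>>0. hausdorff_premeasure s \<delta> E = 0)"
  unfolding hausdorff_measure_def bot_ennreal[symmetric] SUP_bot_conv by auto

lemma hausdorff_measure_zero_subset:
  assumes "hausdorff_measure s F = 0" "E \<subseteq> F"
  shows "hausdorff_measure s E = 0"
  using assms hausdorff_premeasure_mono[OF assms(2)] unfolding hausdorff_measure_eq_0_iff
  by (metis le_zero_eq)

lemma hausdorff_dim_eqI:
  assumes "0 \<le> D"
    and "\<And>s. s > D \<Longrightarrow> hausdorff_measure s E = 0"
    and "\<And>s. 0 \<le> s \<Longrightarrow> s < D \<Longrightarrow> hausdorff_measure s E \<noteq> 0"
  shows "hausdorff_dim E = ereal D"
  unfolding hausdorff_dim_def
proof (rule antisym)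
  show "(INF s\<in>{s. 0 \<le> s \<and> hausdorff_measure s E = 0}. ereal s) \<le> ereal D"
  proof (rule ereal_le_epsilon2)
    fix e :: real assume "0 < e"
    then have "D + e \<in> {s. 0 \<le> s \<and> hausdorff_measure s E = 0}" using assms(1,2) by auto
    then have "(INF s\<in>{s. 0 \<le> s \<and> hausdorff_measure s E = 0}. ereal s) \<le> ereal (D + e)"
      by (rule INF_lower)
    then show "(INF s\<in>{s. 0 \<le> s \<and> hausdorff_measure s E = 0}. ereal s) \<le> ereal D + ereal e" by simp
  qed
  show "ereal D \<le> (INF s\<in>{s. 0 \<le> s \<and> hausdorff_measure s E = 0}. ereal s)"
    using assms(3) by (intro INF_greatest) (force simp: not_less[symmetric])
qed

section \<open>The mass distribution principle for finite point sets\<close>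

lemma nested_compact_subset_open:
  fixes K :: "nat \<Rightarrow> 'a::heine_borel set"
  assumes "\<And>k. compact (K k)" "\<And>k. K (Suc k) \<subseteq> K k" "open V" "(\<Inter>k. K k) \<subseteq> V"
  obtains k0 where "\<And>k. k0 \<le> k \<Longrightarrow> K k \<subseteq> V"
proof -
  have dec: "K k \<subseteq> K j" if "j \<le> k" for j k
    using that assms(2) by (rule lift_Suc_antimono_le[rotated])
  have "\<exists>k0. K k0 - V = {}"
  proof (rule ccontr)
    assume "\<not> ?thesis"
    then have "\<Inter>(range (\<lambda>k. K k - V)) \<noteq> {}"
    proof (intro compact_nest)
      show "K n - V \<subseteq> K m - V" if "m \<le> n" for m n using dec[OF that] by blast
    qed (use assms(1,3) in \<open>auto simp: compact_diff\<close>)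
    then show False using assms(4) by blast
  qed
  then show ?thesis using dec that by blast
qed

text \<open>The finite set \<open>S k\<close> with its normalised counting measure replaces the measure \<open>\<mu>\<close> of the
classical mass distribution principle, and the growth condition \<open>\<mu> U \<le> C diam(U)\<^sup>\<sigma>\<close> is
required only for scales above \<open>\<epsilon> k\<close>. This suffices: after enlarging the sets of a cover to open
sets with positive diameter bounds, compactness leaves finitely many of them; for large \<open>k\<close> they still cover
\<open>S k\<close>, and all their bounds exceed \<open>\<epsilon> k\<close>.\<close>

lemma hausdorff_measure_nonzero_if_discrete_mass:
  fixes K S :: "nat \<Rightarrow> 'a::heine_borel set"
  assumes compact: "\<And>k. compact (K k)" and dec: "\<And>k. K (Suc k) \<subseteq> K k"
    and sub: "\<And>k. S k \<subseteq> K k" and fin: "\<And>k. finite (S k)" and ne: "\<And>k. S k \<noteq> {}"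
    and eps: "\<epsilon> \<longlonglongrightarrow> 0"
    and t: "0 \<le> t" "t \<le> \<sigma>" and \<sigma>: "0 < \<sigma>" and C: "0 < C"
    and count: "\<And>k U r. \<lbrakk>U \<subseteq> S k; \<epsilon> k \<le> r; 0 < r; r \<le> 1; \<And>x y. x \<in> U \<Longrightarrow> y \<in> U \<Longrightarrow> dist x y \<le> r\<rbrakk>
        \<Longrightarrow> real (card U) \<le> C * r powr \<sigma> * real (card (S k))"
  shows "hausdorff_measure t (\<Inter>k. K k) \<noteq> 0"
proof
  let ?E = "\<Inter>k. K k"
  define e where "e = 1 / (4 * C)"
  have e: "0 < e" using C by (simp add: e_def)
  assume "hausdorff_measure t ?E = 0"
  then have "hausdorff_premeasure t (1/2) ?E = 0"
    by (simp add: hausdorff_measure_eq_0_iff)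
  then have "hausdorff_premeasure t (1/2) ?E < ennreal e"
    using e by simp
  then obtain U where U: "U \<in> delta_covers (1/2) ?E" and Us: "(\<Sum>i. hausdorff_weight t (U i)) < ennreal e"
    unfolding hausdorff_premeasure_def INF_less_iff by blast
  define d where "d i = diameter (U i)" for i
  have d: "0 \<le> d i" "d i \<le> 1/2" "bounded (U i)" for i
    using U diameter_ge_0 by (auto simp: d_def delta_covers_def)
  have w: "ennreal (d i powr \<sigma>) \<le> hausdorff_weight t (U i)" for i
  proof (cases "U i = {} \<or> d i = 0")
    case True then show ?thesis using \<sigma> by (auto simp: d_def)
  next
    case False
    then have "0 < d i" "U i \<noteq> {}" using d[of i] by auto
    then have "d i powr \<sigma> \<le> d i powr t" "d i powr \<sigma> \<le> 1"
      using d[of i] t \<sigma> by (auto intro: powr_mono' powr_le1)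
    then show ?thesis using \<open>U i \<noteq> {}\<close>
      by (auto simp: hausdorff_weight_def d_def intro: ennreal_leI)
  qed
  \<comment> \<open>Each covering set is enlarged to an open one at a cost of \<open>e / 2 ^ Suc i\<close>.\<close>
  have "\<exists>r>d i. r \<le> 1 \<and> r powr \<sigma> \<le> d i powr \<sigma> + e * (1/2) ^ Suc i" for i
  proof -
    have "((\<lambda>r. r powr \<sigma>) \<longlongrightarrow> d i powr \<sigma>) (at_right (d i))"
      using \<sigma> d(1)[of i] by (intro tendsto_powr2 tendsto_intros) (auto simp: eventually_at_right_less eventually_at_filter)
    then have "eventually (\<lambda>r. r powr \<sigma> < d i powr \<sigma> + e * (1/2) ^ Suc i) (at_right (d i))"
      using e by (intro order_tendstoD(2)) auto
    moreover have "eventually (\<lambda>r. r \<in> {d i<..<1}) (at_right (d i))"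
      using d(2)[of i] by (intro eventually_at_right_real) auto
    ultimately have "eventually (\<lambda>r. r > d i \<and> r \<le> 1 \<and> r powr \<sigma> \<le> d i powr \<sigma> + e * (1/2) ^ Suc i) (at_right (d i))"
      by eventually_elim auto
    then show ?thesis
      using eventually_happens[of _ "at_right (d i)"] by (auto simp: trivial_limit_at_right_real)
  qed
  then obtain r where r: "\<And>i. d i < r i" "\<And>i. r i \<le> 1" and rs: "\<And>i. r i powr \<sigma> \<le> d i powr \<sigma> + e * (1/2) ^ Suc i"
    by metis
  define V where "V i = (\<Union>x\<in>U i. ball x ((r i - d i) / 2))" for i
  have V: "open (V i)" "U i \<subseteq> V i" for i
    using r(1)[of i] by (auto simp: V_def)
  have Vd: "dist x y \<le> r i" if xy: "x \<in> V i" "y \<in> V i" for x y i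
  proof -
    obtain a b where "a \<in> U i" "b \<in> U i" "dist a x < (r i - d i) / 2" "dist b y < (r i - d i) / 2"
      using xy by (auto simp: V_def)
    moreover have "dist a b \<le> d i"
      using calculation d(3)[of i] by (simp add: d_def diameter_bounded_bound)
    ultimately show ?thesis
      by (smt (verit) dist_commute dist_triangle field_sum_of_halves)
  qed
  have "?E \<subseteq> (\<Union>i. U i)" using U by (simp add: delta_covers_def)
  also have "\<dots> \<subseteq> (\<Union>i. V i)" using V(2) by blast
  finally have "?E \<subseteq> (\<Union>i. V i)" .
  moreover have "compact ?E" using compact by (intro compact_Inter) auto
  ultimately obtain I where I: "finite I" "?E \<subseteq> (\<Union>i\<in>I. V i)"
    using V(1) compactE_image[of ?E UNIV V] by auto
  obtain k0 where k0: "\<And>k. k0 \<le> k \<Longrightarrow> K k \<subseteq> (\<Union>i\<in>I. V i)"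
    using nested_compact_subset_open[OF compact dec _ I(2)] V(1) by blast
  have "eventually (\<lambda>k. \<forall>i\<in>I. \<epsilon> k < r i) sequentially"
  proof (intro eventually_ball_finite ballI I)
    fix i
    have "0 < r i" using r(1)[of i] d(1)[of i] by linarith
    then show "eventually (\<lambda>k. \<epsilon> k < r i) sequentially" using order_tendstoD(2)[OF eps] by blast
  qed
  then obtain k where k: "k0 \<le> k" "\<And>i. i \<in> I \<Longrightarrow> \<epsilon> k < r i"
    by (metis (mono_tags, lifting) eventually_sequentially linear)
  let ?n = "real (card (S k))"
  have n: "0 < ?n" using fin ne by (simp add: card_gt_0_iff)
  have "?n = real (card (\<Union>i\<in>I. S k \<inter> V i))"
    using k0[OF k(1)] sub[of k] by (intro arg_cong[where f="\<lambda>A. real (card A)"]) blast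
  also have "\<dots> \<le> (\<Sum>i\<in>I. real (card (S k \<inter> V i)))"
    using card_UN_le[OF I(1), of "\<lambda>i. S k \<inter> V i"] by (metis (mono_tags) of_nat_le_iff of_nat_sum)
  also have "\<dots> \<le> (\<Sum>i\<in>I. C * r i powr \<sigma> * ?n)"
  proof (intro sum_mono count)
    fix i assume "i \<in> I"
    then show "\<epsilon> k \<le> r i" using k(2)[of i] by linarith
    show "0 < r i" using r(1)[of i] d(1)[of i] by linarith
  qed (use r Vd in auto)
  also have "\<dots> = C * ?n * (\<Sum>i\<in>I. r i powr \<sigma>)"
    by (simp add: sum_distrib_left mult_ac)
  also have "(\<Sum>i\<in>I. r i powr \<sigma>) \<le> 2 * e"
  proof -
    have "ennreal (\<Sum>i\<in>I. r i powr \<sigma>) = (\<Sum>i\<in>I. ennreal (r i powr \<sigma>))" by simp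
    also have "\<dots> \<le> (\<Sum>i\<in>I. hausdorff_weight t (U i) + ennreal (e * (1/2) ^ Suc i))"
    proof (intro sum_mono)
      fix i
      have "ennreal (r i powr \<sigma>) \<le> ennreal (d i powr \<sigma> + e * (1/2) ^ Suc i)"
        using rs by (rule ennreal_leI)
      also have "\<dots> = ennreal (d i powr \<sigma>) + ennreal (e * (1/2) ^ Suc i)"
        using e by (intro ennreal_plus) auto
      also have "\<dots> \<le> hausdorff_weight t (U i) + ennreal (e * (1/2) ^ Suc i)"
        by (intro add_right_mono w)
      finally show "ennreal (r i powr \<sigma>) \<le> hausdorff_weight t (U i) + ennreal (e * (1/2) ^ Suc i)" .
    qed
    also have "\<dots> \<le> (\<Sum>i. hausdorff_weight t (U i) + ennreal (e * (1/2) ^ Suc i))"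
      by (intro sum_le_suminf I) auto
    also have "\<dots> = (\<Sum>i. hausdorff_weight t (U i)) + (\<Sum>i. ennreal (e * (1/2) ^ Suc i))"
      by (intro suminf_add[symmetric]) auto
    also have "(\<Sum>i. ennreal (e * (1/2) ^ Suc i)) = ennreal e"
      using sums_mult[OF power_half_series, of e] e by (intro suminf_ennreal_eq) auto
    also have "(\<Sum>i. hausdorff_weight t (U i)) + ennreal e \<le> ennreal e + ennreal e"
      using Us by (intro add_right_mono) auto
    also have "\<dots> = ennreal (2 * e)" using e by (simp flip: ennreal_plus)
    finally show ?thesis using e by simp
  qed
  finally have "?n \<le> C * ?n * (2 * e)" using C n by (simp add: mult_left_mono)
  then show False using n C by (simp add: e_def)
qed

section \<open>Upper bounds: covering by slabs\<close>

text \<open>The integer vectors of supremum norm \<open>N\<close>, described by their coordinates so that they can be counted.\<close>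

definition int_shell :: "nat \<Rightarrow> (int ^ 'm) set" where
  "int_shell N = {w. (\<forall>i. \<bar>w $ i\<bar> \<le> int N) \<and> (\<exists>i. \<bar>w $ i\<bar> = int N)}"

lemma infnorm_cart_eqI:
  fixes x :: "real ^ 'm"
  assumes "\<And>i. \<bar>x $ i\<bar> \<le> b" "\<bar>x $ i0\<bar> = b"
  shows "infnorm x = b"
proof (rule antisym)
  show "infnorm x \<le> b" unfolding infnorm_cart by (rule cSup_least) (use assms(1) in auto)
  show "b \<le> infnorm x" using component_le_infnorm_cart[of x i0] assms(2) by simp
qed

lemma infnorm_int_shell: "w \<in> int_shell N \<Longrightarrow> infnorm (int_vec w) = real N"
proof -
  assume "w \<in> int_shell N"
  then obtain i0 where i: "\<And>i. \<bar>w $ i\<bar> \<le> int N" "\<bar>w $ i0\<bar> = int N" by (auto simp: int_shell_def)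
  have "\<bar>real_of_int (w $ i)\<bar> \<le> real N" for i using i(1)[of i] by linarith
  moreover have "\<bar>real_of_int (w $ i0)\<bar> = real N" using i(2) by linarith
  ultimately show ?thesis by (intro infnorm_cart_eqI[of _ _ i0]) (simp_all add: int_vec_def)
qed

lemma int_shell_exists: "\<exists>N. w \<in> int_shell N"
proof -
  let ?A = "range (\<lambda>i. \<bar>w $ i\<bar>)"
  have "Max ?A \<in> ?A" by (intro Max_in) auto
  then obtain i where i: "\<bar>w $ i\<bar> = Max ?A" by (metis imageE)
  then have "0 \<le> Max ?A" by (metis abs_ge_zero)
  then have "w \<in> int_shell (nat (Max ?A))" using i by (auto simp: int_shell_def)
  then show ?thesis ..
qed

text \<open>One of the coordinates is \<open>\<plusminus>N\<close>, which costs one power of \<open>N\<close> in the count.\<close>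

lemma finite_int_shell: "finite (int_shell N :: (int ^ 'm) set)"
  and card_int_shell_le: "1 \<le> N \<Longrightarrow>
    real (card (int_shell N :: (int ^ 'm) set)) \<le> real CARD('m) * 2 * (3 * real N) ^ (CARD('m) - 1)"
proof -
  let ?B = "\<lambda>i0::'m. PiE UNIV (\<lambda>i. if i = i0 then {- int N, int N} else {- int N..int N})"
  have finB: "finite (?B i0)" for i0 by (intro finite_PiE) auto
  have sub: "(\<lambda>w::int^'m. ($) w) ` int_shell N \<subseteq> (\<Union>i0. ?B i0)"
  proof
    fix f assume "f \<in> (\<lambda>w::int^'m. ($) w) ` int_shell N"
    then obtain w :: "int ^ 'm" and i0 where "f = ($) w" "\<And>i. \<bar>w $ i\<bar> \<le> int N" "\<bar>w $ i0\<bar> = int N"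
      by (auto simp: int_shell_def)
    then have "f \<in> ?B i0" by (force simp: abs_le_iff)
    then show "f \<in> (\<Union>i0. ?B i0)" by blast
  qed
  have inj: "inj_on (\<lambda>w::int^'m. ($) w) (int_shell N)" by (auto intro!: inj_onI simp: vec_eq_iff)
  have finU: "finite (\<Union>i0. ?B i0)" using finB by (intro finite_UN_I) auto
  show "finite (int_shell N :: (int ^ 'm) set)"
    using finite_subset[OF sub finU] inj by (rule finite_imageD)
  assume N: "1 \<le> N"
  have cardB: "card (?B i0) = 2 * (2 * N + 1) ^ (CARD('m) - 1)" for i0
  proof -
    have "card (?B i0) = (\<Prod>i\<in>UNIV. card (if i = i0 then {- int N, int N} else {- int N..int N}))"
      by (simp add: card_PiE)
    also have "\<dots> = card {- int N, int N} * (\<Prod>i\<in>UNIV - {i0}. card {- int N..int N})"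
      by (subst prod.remove[of _ i0]) auto
    also have "\<dots> = 2 * (2 * N + 1) ^ (CARD('m) - 1)"
    proof -
      have "nat (2 * int N + 1) = 2 * N + 1" by linarith
      then show ?thesis using N by (simp add: card_Diff_singleton)
    qed
    finally show ?thesis .
  qed
  have "card (int_shell N :: (int ^ 'm) set) \<le> card (\<Union>i0. ?B i0)"
    using card_mono[OF finU sub] card_image[OF inj] by simp
  also have "\<dots> \<le> (\<Sum>i0\<in>UNIV. card (?B i0))" by (rule card_UN_le) simp
  also have "\<dots> = CARD('m) * (2 * (2 * N + 1) ^ (CARD('m) - 1))" by (simp add: cardB)
  finally have "real (card (int_shell N :: (int ^ 'm) set)) \<le> real (CARD('m) * (2 * (2 * N + 1) ^ (CARD('m) - 1)))"
    by (rule of_nat_mono)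
  also have "\<dots> = real CARD('m) * 2 * real (2 * N + 1) ^ (CARD('m) - 1)" by (simp only: of_nat_mult of_nat_power of_nat_numeral mult.assoc)
  also have "\<dots> \<le> real CARD('m) * 2 * (3 * real N) ^ (CARD('m) - 1)"
    using N by (intro mult_left_mono power_mono) auto
  finally show "real (card (int_shell N :: (int ^ 'm) set)) \<le> real CARD('m) * 2 * (3 * real N) ^ (CARD('m) - 1)" .
qed

lemma norm_matrix_le:
  fixes X :: "real ^ 'n ^ 'm"
  assumes "\<And>i j. \<bar>X $ i $ j\<bar> \<le> e"
  shows "norm X \<le> real (CARD('m) * CARD('n)) * e"
proof -
  have "norm X \<le> (\<Sum>i\<in>UNIV. norm (X $ i))" unfolding norm_vec_def by (intro L2_set_le_sum) auto
  also have "\<dots> \<le> (\<Sum>i\<in>(UNIV::'m set). \<Sum>j\<in>(UNIV::'n set). \<bar>X $ i $ j\<bar>)" by (intro sum_mono norm_le_l1_cart)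
  also have "\<dots> \<le> (\<Sum>i\<in>(UNIV::'m set). \<Sum>j\<in>(UNIV::'n set). e)" by (intro sum_mono assms)
  finally show ?thesis by simp
qed

definition slab :: "int ^ 'm \<Rightarrow> real \<Rightarrow> (real ^ 'n ^ 'm) set" where
  "slab w c = {X \<in> unit_cube_matrices. \<forall>j. \<bar>\<Sum>i\<in>UNIV. real_of_int (w $ i) * X $ i $ j\<bar> \<le> c}"

lemma int_vec_matrix_mult: "(int_vec w v* X) $ j = (\<Sum>i\<in>UNIV. real_of_int (w $ i) * X $ i $ j)"
  by (simp add: vector_matrix_mult_def int_vec_def mult.commute)

text \<open>Let \<open>i0\<close> be a coordinate where \<open>|w|\<close> attains its maximum \<open>N\<close>. Once the rows other than \<open>i0\<close> are known up to
\<open>\<epsilon>\<close>, the condition \<open>|wX| \<le> N \<epsilon>\<close> pins down row \<open>i0\<close> up to a multiple of \<open>\<epsilon>\<close>. Hence the cells of an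
\<open>\<epsilon>\<close>-grid in \<open>(m - 1) n\<close> variables give a cover by sets of diameter comparable to \<open>\<epsilon>\<close>.\<close>

lemma slab_premeasure_le:
  fixes w :: "int ^ 'm"
  defines "D \<equiv> real (CARD('m) * CARD('n)) * real (CARD('m) + 1)"
  assumes w: "w \<in> int_shell N" "1 \<le> N" and \<epsilon>: "0 < \<epsilon>" "\<epsilon> \<le> 1" "D * \<epsilon> \<le> \<delta>" and s: "0 < s"
  shows "hausdorff_premeasure s \<delta> (slab w (real N * \<epsilon>) :: (real ^ 'n ^ 'm) set)
    \<le> ennreal ((3 / \<epsilon>) ^ ((CARD('m) - 1) * CARD('n)) * (D * \<epsilon>) powr s)"
proof -
  obtain i0 where i0: "\<And>i. \<bar>w $ i\<bar> \<le> int N" "\<bar>w $ i0\<bar> = int N" using w(1) by (auto simp: int_shell_def)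
  let ?S = "slab w (real N * \<epsilon>) :: (real ^ 'n ^ 'm) set"
  let ?J = "(UNIV - {i0}) \<times> (UNIV :: 'n set)"
  let ?F = "PiE ?J (\<lambda>_. {\<lfloor>- 1 / (2 * \<epsilon>)\<rfloor>..\<lfloor>1 / (2 * \<epsilon>)\<rfloor>})"
  define key where "key X = (\<lambda>(i, j)\<in>?J. \<lfloor>X $ i $ j / \<epsilon>\<rfloor>)" for X :: "real ^ 'n ^ 'm"
  have D0: "0 < D" by (simp add: D_def)
  have finF: "finite ?F" by (intro finite_PiE) auto
  have key: "key X \<in> ?F" if "X \<in> ?S" for X
  proof (rule PiE_I)
    fix ij assume ij: "ij \<in> ?J"
    have "- 1 / 2 \<le> X $ fst ij $ snd ij" "X $ fst ij $ snd ij \<le> 1 / 2"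
      using that by (auto simp: slab_def unit_cube_matrices_def)
    then have "- 1 / 2 / \<epsilon> \<le> X $ fst ij $ snd ij / \<epsilon>" "X $ fst ij $ snd ij / \<epsilon> \<le> 1 / 2 / \<epsilon>"
      using \<epsilon>(1) by (intro divide_right_mono; simp)+
    then show "key X ij \<in> {\<lfloor>- 1 / (2 * \<epsilon>)\<rfloor>..\<lfloor>1 / (2 * \<epsilon>)\<rfloor>}"
      using ij by (auto simp: key_def split_def intro!: floor_mono)
  qed (auto simp: key_def)
  \<comment> \<open>The coordinate where \<open>w\<close> is extremal lets the defining inequality determine the row \<open>i0\<close>.\<close>
  have close: "norm (X - Y) \<le> D * \<epsilon>" if X: "X \<in> ?S" and Y: "Y \<in> ?S" and eq: "key X = key Y" for X Y
  proof -
    have other: "\<bar>X $ i $ j - Y $ i $ j\<bar> \<le> \<epsilon>" if "i \<noteq> i0" for i j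
    proof -
      have "\<lfloor>X $ i $ j / \<epsilon>\<rfloor> = \<lfloor>Y $ i $ j / \<epsilon>\<rfloor>"
        using fun_cong[OF eq, of "(i, j)"] that by (simp add: key_def)
      then have "\<bar>X $ i $ j / \<epsilon> - Y $ i $ j / \<epsilon>\<bar> \<le> 1" by linarith
      then have "\<bar>X $ i $ j - Y $ i $ j\<bar> / \<epsilon> \<le> 1" using \<epsilon>(1) by (simp add: abs_divide flip: diff_divide_distrib)
      then show ?thesis using \<epsilon>(1) by simp
    qed
    have row: "\<bar>X $ i0 $ j - Y $ i0 $ j\<bar> \<le> real (CARD('m) + 1) * \<epsilon>" for j
    proof -
      let ?s = "\<lambda>X::real^'n^'m. \<Sum>i\<in>UNIV - {i0}. real_of_int (w $ i) * X $ i $ j"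
      have split: "(\<Sum>i\<in>UNIV. real_of_int (w $ i) * Z $ i $ j) = real_of_int (w $ i0) * Z $ i0 $ j + ?s Z" for Z :: "real ^ 'n ^ 'm"
        by (subst sum.remove[of _ i0]) auto
      have "\<bar>?s X - ?s Y\<bar> \<le> (\<Sum>i\<in>UNIV - {i0}. \<bar>real_of_int (w $ i) * (X $ i $ j - Y $ i $ j)\<bar>)"
        by (simp add: right_diff_distrib sum_subtractf[symmetric] sum_abs)
      also have "\<dots> \<le> (\<Sum>i\<in>UNIV - {i0}. real N * \<epsilon>)"
      proof (intro sum_mono)
        fix i assume "i \<in> UNIV - {i0}"
        moreover have "\<bar>real_of_int (w $ i)\<bar> \<le> real N" using i0(1)[of i] by linarith
        ultimately show "\<bar>real_of_int (w $ i) * (X $ i $ j - Y $ i $ j)\<bar> \<le> real N * \<epsilon>"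
          using other[of i j] unfolding abs_mult by (intro mult_mono) auto
      qed
      also have "\<dots> = (real CARD('m) - 1) * (real N * \<epsilon>)"
        by (simp add: card_Diff_singleton of_nat_diff Suc_leI)
      finally have 1: "\<bar>?s X - ?s Y\<bar> \<le> (real CARD('m) - 1) * (real N * \<epsilon>)" .
      have "\<bar>real_of_int (w $ i0) * X $ i0 $ j + ?s X\<bar> \<le> real N * \<epsilon>" "\<bar>real_of_int (w $ i0) * Y $ i0 $ j + ?s Y\<bar> \<le> real N * \<epsilon>"
      proof -
        have "\<bar>\<Sum>i\<in>UNIV. real_of_int (w $ i) * X $ i $ j\<bar> \<le> real N * \<epsilon>"
          "\<bar>\<Sum>i\<in>UNIV. real_of_int (w $ i) * Y $ i $ j\<bar> \<le> real N * \<epsilon>"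
          using X Y unfolding slab_def by blast+
        then show "\<bar>real_of_int (w $ i0) * X $ i0 $ j + ?s X\<bar> \<le> real N * \<epsilon>" "\<bar>real_of_int (w $ i0) * Y $ i0 $ j + ?s Y\<bar> \<le> real N * \<epsilon>"
          unfolding split .
      qed
      then have "\<bar>real_of_int (w $ i0) * X $ i0 $ j - real_of_int (w $ i0) * Y $ i0 $ j\<bar> \<le> (real CARD('m) - 1) * (real N * \<epsilon>) + 2 * (real N * \<epsilon>)"
        using 1 by linarith
      moreover have "\<bar>real_of_int (w $ i0) * X $ i0 $ j - real_of_int (w $ i0) * Y $ i0 $ j\<bar> = real N * \<bar>X $ i0 $ j - Y $ i0 $ j\<bar>"
      proof -
        have "\<bar>real_of_int (w $ i0)\<bar> = real N" using i0(2) by linarith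
        then show ?thesis by (metis abs_mult right_diff_distrib)
      qed
      ultimately have "real N * \<bar>X $ i0 $ j - Y $ i0 $ j\<bar> \<le> real N * (real (CARD('m) + 1) * \<epsilon>)"
        by (simp add: algebra_simps)
      then show ?thesis using w(2) by simp
    qed
    have "\<bar>(X - Y) $ i $ j\<bar> \<le> real (CARD('m) + 1) * \<epsilon>" for i j
    proof (cases "i = i0")
      case False
      have "1 * \<epsilon> \<le> real (CARD('m) + 1) * \<epsilon>" using \<epsilon>(1) by (intro mult_right_mono) auto
      then show ?thesis using other[OF False, of j] by simp
    qed (use row in simp)
    then have "norm (X - Y) \<le> real (CARD('m) * CARD('n)) * (real (CARD('m) + 1) * \<epsilon>)" by (rule norm_matrix_le)
    then show ?thesis by (simp add: D_def mult.assoc)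
  qed
  have piece: "hausdorff_premeasure s \<delta> {X \<in> ?S. key X = f} \<le> ennreal ((D * \<epsilon>) powr s)" for f
  proof -
    let ?U = "{X \<in> ?S. key X = f}"
    have "dist X Y \<le> D * \<epsilon>" if "X \<in> ?U" "Y \<in> ?U" for X Y
      using close[of X Y] that by (simp add: dist_norm)
    then have bdd: "bounded ?U" unfolding bounded_two_points by blast
    have diam: "diameter ?U \<le> D * \<epsilon>"
      using close D0 \<epsilon>(1) by (intro diameter_le) auto
    have "hausdorff_premeasure s \<delta> ?U \<le> hausdorff_weight s ?U"
      using bdd diam \<epsilon>(3) by (intro hausdorff_premeasure_single) auto
    also have "\<dots> \<le> ennreal ((D * \<epsilon>) powr s)"
      using diam diameter_ge_0[OF bdd] s by (auto simp: hausdorff_weight_def intro!: ennreal_leI powr_mono2)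
    finally show ?thesis .
  qed
  have "?S = (\<Union>f\<in>?F. {X \<in> ?S. key X = f})" using key by blast
  then have "hausdorff_premeasure s \<delta> ?S = hausdorff_premeasure s \<delta> (\<Union>f\<in>?F. {X \<in> ?S. key X = f})" by simp
  also have "\<dots> \<le> (\<Sum>f\<in>?F. hausdorff_premeasure s \<delta> {X \<in> ?S. key X = f})"
  proof (rule hausdorff_premeasure_finite_UN_le[OF finF])
    have "0 < D * \<epsilon>" using D0 \<epsilon>(1) by simp
    then show "0 \<le> \<delta>" using \<epsilon>(3) by linarith
  qed
  also have "\<dots> \<le> (\<Sum>f\<in>?F. ennreal ((D * \<epsilon>) powr s))" by (rule sum_mono) (rule piece)
  also have "\<dots> = ennreal (real (card ?F) * (D * \<epsilon>) powr s)"
    by (simp add: ennreal_mult ennreal_of_nat_eq_real_of_nat)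
  also have "\<dots> \<le> ennreal ((3 / \<epsilon>) ^ ((CARD('m) - 1) * CARD('n)) * (D * \<epsilon>) powr s)"
  proof (intro ennreal_leI mult_right_mono)
    let ?k = "nat (\<lfloor>1 / (2 * \<epsilon>)\<rfloor> - \<lfloor>- 1 / (2 * \<epsilon>)\<rfloor> + 1)"
    have "card ?F = ?k ^ ((CARD('m) - 1) * CARD('n))"
      by (simp add: card_PiE card_cartesian_product card_Diff_singleton)
    moreover have "real ?k \<le> 3 / \<epsilon>"
    proof -
      have "1 \<le> 1 / \<epsilon>" using \<epsilon> by simp
      then have "1 / (2 * \<epsilon>) - (- 1 / (2 * \<epsilon>) - 1) + 1 \<le> 3 / \<epsilon>" by (simp add: field_simps)
      moreover have "real ?k \<le> 1 / (2 * \<epsilon>) - (- 1 / (2 * \<epsilon>) - 1) + 1"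
      proof -
        have "0 \<le> 1 / (2 * \<epsilon>)" "- 1 / (2 * \<epsilon>) \<le> 0" using \<epsilon>(1) by auto
        then show ?thesis by linarith
      qed
      ultimately show ?thesis by linarith
    qed
    ultimately show "real (card ?F) \<le> (3 / \<epsilon>) ^ ((CARD('m) - 1) * CARD('n))"
      by (simp only: of_nat_power) (intro power_mono; simp)
  qed simp
  finally show ?thesis .
qed

lemma shell_premeasure_le:
  fixes s :: real
  assumes s: "0 < s"
  obtains A D :: real where "0 < A" "0 < D"
    "\<And>N \<epsilon> \<delta>. \<lbrakk>1 \<le> N; 0 < \<epsilon>; \<epsilon> \<le> 1; D * \<epsilon> \<le> \<delta>\<rbrakk> \<Longrightarrow>
      hausdorff_premeasure s \<delta> (\<Union>w\<in>(int_shell N :: (int ^ 'm) set). slab w (real N * \<epsilon>) :: (real ^ 'n ^ 'm) set)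
      \<le> ennreal (A * real N powr (real CARD('m) - 1) * \<epsilon> powr (s - (real CARD('m) - 1) * real CARD('n)))"
proof -
  define D where "D = real (CARD('m) * CARD('n)) * real (CARD('m) + 1)"
  define A where "A = (real CARD('m) * 2 * 3 ^ (CARD('m) - 1)) * (3 ^ ((CARD('m) - 1) * CARD('n)) * D powr s)"
  have D: "0 < D" by (simp add: D_def)
  then have A: "0 < A" by (simp add: A_def)
  have m1: "1 \<le> CARD('m)" by (simp add: Suc_leI)
  show ?thesis
  proof (rule that[OF A D])
    fix N :: nat and \<epsilon> \<delta> :: real assume N: "1 \<le> N" and \<epsilon>: "0 < \<epsilon>" "\<epsilon> \<le> 1" "D * \<epsilon> \<le> \<delta>"
    let ?W = "int_shell N :: (int ^ 'm) set"
    let ?b = "(3 / \<epsilon>) ^ ((CARD('m) - 1) * CARD('n)) * (D * \<epsilon>) powr s"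
    have "0 < D * \<epsilon>" using D \<epsilon>(1) by simp
    then have \<delta>: "0 \<le> \<delta>" using \<epsilon>(3) by linarith
    have "hausdorff_premeasure s \<delta> (\<Union>w\<in>?W. slab w (real N * \<epsilon>) :: (real ^ 'n ^ 'm) set)
        \<le> (\<Sum>w\<in>?W. hausdorff_premeasure s \<delta> (slab w (real N * \<epsilon>) :: (real ^ 'n ^ 'm) set))"
      by (rule hausdorff_premeasure_finite_UN_le[OF finite_int_shell \<delta>])
    also have "\<dots> \<le> (\<Sum>w\<in>?W. ennreal ?b)"
      using N \<epsilon> s unfolding D_def by (intro sum_mono slab_premeasure_le) auto
    also have "\<dots> = ennreal (real (card ?W) * ?b)"
      using \<epsilon>(1) by (simp add: ennreal_mult ennreal_of_nat_eq_real_of_nat)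
    also have "\<dots> \<le> ennreal ((real CARD('m) * 2 * (3 * real N) ^ (CARD('m) - 1)) * ?b)"
      using \<epsilon>(1) N by (intro ennreal_leI mult_right_mono card_int_shell_le) auto
    also have "(real CARD('m) * 2 * (3 * real N) ^ (CARD('m) - 1)) * ?b
        = A * real N powr (real CARD('m) - 1) * \<epsilon> powr (s - (real CARD('m) - 1) * real CARD('n))"
    proof -
      have "real N ^ (CARD('m) - 1) = real N powr (real CARD('m) - 1)"
        using N m1 by (simp add: of_nat_diff flip: powr_realpow)
      moreover have "(1 / \<epsilon>) ^ ((CARD('m) - 1) * CARD('n)) = \<epsilon> powr (- ((real CARD('m) - 1) * real CARD('n)))"
        using \<epsilon>(1) m1 by (simp add: of_nat_diff powr_minus power_one_over inverse_eq_divide flip: powr_realpow)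
      moreover have "\<epsilon> powr (- ((real CARD('m) - 1) * real CARD('n))) * \<epsilon> powr s = \<epsilon> powr (s - (real CARD('m) - 1) * real CARD('n))"
        by (simp flip: powr_add)
      moreover have "(3 / \<epsilon>) ^ ((CARD('m) - 1) * CARD('n)) = 3 ^ ((CARD('m) - 1) * CARD('n)) * (1 / \<epsilon>) ^ ((CARD('m) - 1) * CARD('n))"
        by (simp flip: power_mult_distrib)
      moreover have "(D * \<epsilon>) powr s = D powr s * \<epsilon> powr s" using D \<epsilon>(1) by (simp add: powr_mult)
      ultimately show ?thesis by (simp add: A_def power_mult_distrib mult.assoc mult.left_commute)
    qed
    finally show "hausdorff_premeasure s \<delta> (\<Union>w\<in>?W. slab w (real N * \<epsilon>) :: (real ^ 'n ^ 'm) set)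
      \<le> ennreal (A * real N powr (real CARD('m) - 1) * \<epsilon> powr (s - (real CARD('m) - 1) * real CARD('n)))" .
  qed
qed

lemma W0_in_far_shell:
  fixes X :: "real ^ 'n ^ 'm"
  assumes "X \<in> W0 \<tau>"
  obtains R and q :: "int ^ 'm" where "N \<le> R" "q \<in> int_shell R" "X \<in> slab q (real R powr (- \<tau>))"
proof -
  let ?Q = "{q :: int ^ 'm. q \<noteq> 0 \<and> infnorm (int_vec q v* X) < infnorm (int_vec q) powr (- \<tau>)}"
  have X: "X \<in> unit_cube_matrices" "infinite ?Q" using assms by (auto simp: W0_def)
  have "\<not> ?Q \<subseteq> (\<Union>R<N. int_shell R)"
    using X(2) finite_subset[of ?Q "\<Union>R<N. int_shell R"] finite_int_shell by blast
  then obtain q where q: "q \<in> ?Q" "q \<notin> (\<Union>R<N. int_shell R)" by blast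
  obtain R where R: "q \<in> int_shell R" using int_shell_exists by blast
  have "N \<le> R" using q(2) R by (auto simp: not_less[symmetric])
  moreover have "\<bar>\<Sum>i\<in>UNIV. real_of_int (q $ i) * X $ i $ j\<bar> \<le> real R powr (- \<tau>)" for j
    using component_le_infnorm_cart[of "int_vec q v* X" j] q(1) infnorm_int_shell[OF R]
    by (simp add: int_vec_matrix_mult)
  then have "X \<in> slab q (real R powr (- \<tau>))" using X(1) by (simp add: slab_def)
  ultimately show ?thesis using R that by blast
qed

text \<open>The vector \<open>w\<close> is obtained from some \<open>q\<close> with \<open>|q| \<ge> N\<close> and \<open>|qX| \<le> 1\<close> by shrinking \<open>q\<close> to norm \<open>N\<close> and
rounding each coordinate. Scaling does not increase \<open>|qX|\<close>, rounding changes it by a bounded amount, and the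
extremal coordinate stays exactly \<open>\<plusminus>N\<close>.\<close>

lemma W0_meets_every_shell:
  fixes X :: "real ^ 'n ^ 'm"
  assumes "X \<in> W0 \<tau>" "0 < \<tau>" "1 \<le> N"
  shows "\<exists>w\<in>int_shell N. X \<in> slab w (real (CARD('m) + 1))"
proof -
  obtain R and q :: "int ^ 'm" where R: "N \<le> R" and q: "q \<in> int_shell R" "X \<in> slab q (real R powr (- \<tau>))"
    using W0_in_far_shell[OF assms(1)] .
  have X: "X \<in> unit_cube_matrices" using q(2) by (simp add: slab_def)
  have R0: "0 < real R" using R assms(3) by simp
  obtain i0 where i0: "\<And>i. \<bar>q $ i\<bar> \<le> int R" "\<bar>q $ i0\<bar> = int R" using q(1) by (auto simp: int_shell_def)
  define u where "u i = real N * real_of_int (q $ i) / real R" for i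
  define w :: "int ^ 'm" where "w = (\<chi> i. round (u i))"
  have u_le: "\<bar>u i\<bar> \<le> real N" for i
  proof -
    have "\<bar>real_of_int (q $ i)\<bar> \<le> real R" using i0(1)[of i] by linarith
    then have "real N * \<bar>real_of_int (q $ i)\<bar> \<le> real N * real R" by (intro mult_left_mono) auto
    then show ?thesis using R0 by (simp add: u_def abs_mult pos_divide_le_eq)
  qed
  have w: "w \<in> int_shell N"
  proof -
    have "\<bar>w $ i\<bar> \<le> int N" for i
    proof -
      have "round (u i) \<le> round (real N)" "round (- real N) \<le> round (u i)"
        using u_le[of i] unfolding abs_le_iff by (intro round_mono; linarith)+
      moreover have "round (- real N) = - int N" by (metis of_int_minus of_int_of_nat_eq round_of_int)
      ultimately show ?thesis by (simp add: w_def)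
    qed
    moreover have "\<bar>w $ i0\<bar> = int N"
    proof -
      have "q $ i0 = int R \<or> q $ i0 = - int R" using i0(2) by linarith
      then have "u i0 = real N \<or> u i0 = - real N" using R0 by (auto simp: u_def)
      then have "u i0 = real_of_int (int N) \<or> u i0 = real_of_int (- int N)" by simp
      then have "w $ i0 = int N \<or> w $ i0 = - int N" unfolding w_def vec_lambda_beta by (metis round_of_int)
      then show ?thesis by auto
    qed
    ultimately show ?thesis by (auto simp: int_shell_def)
  qed
  have "\<bar>\<Sum>i\<in>UNIV. real_of_int (w $ i) * X $ i $ j\<bar> \<le> real (CARD('m) + 1)" for j
  proof -
    have "(\<Sum>i\<in>UNIV. real_of_int (w $ i) * X $ i $ j) = (\<Sum>i\<in>UNIV. (real_of_int (w $ i) - u i) * X $ i $ j) + (\<Sum>i\<in>UNIV. u i * X $ i $ j)"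
      by (simp add: left_diff_distrib flip: sum.distrib)
    moreover have "\<bar>\<Sum>i\<in>UNIV. (real_of_int (w $ i) - u i) * X $ i $ j\<bar> \<le> (\<Sum>i\<in>(UNIV::'m set). 1)"
    proof (rule order_trans[OF sum_abs sum_mono])
      fix i :: 'm
      have "\<bar>real_of_int (w $ i) - u i\<bar> \<le> 1" using of_int_round_abs_le[of "u i"] by (simp add: w_def)
      moreover have "- 1 / 2 \<le> X $ i $ j \<and> X $ i $ j \<le> 1 / 2" using X by (auto simp: unit_cube_matrices_def)
      then have "\<bar>X $ i $ j\<bar> \<le> 1" by linarith
      ultimately have "\<bar>real_of_int (w $ i) - u i\<bar> * \<bar>X $ i $ j\<bar> \<le> 1 * 1" by (intro mult_mono) auto
      then show "\<bar>(real_of_int (w $ i) - u i) * X $ i $ j\<bar> \<le> 1" by (simp add: abs_mult)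
    qed
    moreover have "\<bar>\<Sum>i\<in>UNIV. u i * X $ i $ j\<bar> \<le> 1"
    proof -
      have "(\<Sum>i\<in>UNIV. u i * X $ i $ j) = real N / real R * (\<Sum>i\<in>UNIV. real_of_int (q $ i) * X $ i $ j)"
        by (simp add: u_def sum_distrib_left mult_ac)
      moreover have "\<bar>\<Sum>i\<in>UNIV. real_of_int (q $ i) * X $ i $ j\<bar> \<le> 1"
      proof -
        have "\<bar>\<Sum>i\<in>UNIV. real_of_int (q $ i) * X $ i $ j\<bar> \<le> real R powr (- \<tau>)" using q(2) by (simp add: slab_def)
        also have "\<dots> \<le> real R powr 0" using R assms(2,3) by (intro powr_mono) auto
        finally show ?thesis using R0 by simp
      qed
      moreover have "real N / real R \<le> 1" "0 \<le> real N / real R" using R R0 by simp_all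
      ultimately show ?thesis by (simp add: abs_mult mult_le_one del: times_divide_eq_left)
    qed
    ultimately show ?thesis by simp
  qed
  then have "X \<in> slab w (real (CARD('m) + 1))" using X by (simp add: slab_def)
  then show ?thesis using w by blast
qed

lemma powr_collect_exponents:
  fixes x :: real
  shows "x powr a * (x powr (- t)) powr e = x powr (a - t * e)"
  by (simp add: powr_powr flip: powr_add)

lemma powr_collect_quotient:
  fixes x c :: real
  shows "A * x powr a * (c / x) powr e = A * c powr e * x powr (a - e)"
  by (simp add: powr_divide powr_diff)

text \<open>Taking \<open>\<epsilon> = N\<close> to the power \<open>- (\<tau> + 1)\<close> in the bound for the slabs of norm \<open>N\<close>, the hypothesis on \<open>s\<close>
says exactly that the resulting powers of \<open>N\<close> are summable.\<close>

lemma W0_null_by_shell_series: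
  fixes \<tau> s :: real
  assumes \<tau>: "0 < \<tau>" and s: "(real CARD('m) - 1) * real CARD('n) + real CARD('m) / (\<tau> + 1) < s"
  shows "hausdorff_measure s (W0 \<tau> :: (real ^ 'n ^ 'm) set) = 0"
  unfolding hausdorff_measure_eq_0_iff
proof (intro allI impI)
  fix \<delta> :: real assume \<delta>: "0 < \<delta>"
  let ?e = "s - (real CARD('m) - 1) * real CARD('n)"
  have m1: "1 \<le> real CARD('m)" by (simp add: Suc_leI)
  have e: "real CARD('m) / (\<tau> + 1) < ?e" using s by linarith
  have "0 < real CARD('m) / (\<tau> + 1)" using \<tau> by simp
  then have s0: "0 < s" using s m1 by (smt (verit) mult_nonneg_nonneg of_nat_0_le_iff)
  obtain A D where AD: "0 < A" "0 < D" and shell: "\<And>N \<epsilon> \<delta>. \<lbrakk>1 \<le> N; 0 < \<epsilon>; \<epsilon> \<le> 1; D * \<epsilon> \<le> \<delta>\<rbrakk> \<Longrightarrow>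
      hausdorff_premeasure s \<delta> (\<Union>w\<in>(int_shell N :: (int ^ 'm) set). slab w (real N * \<epsilon>) :: (real ^ 'n ^ 'm) set)
      \<le> ennreal (A * real N powr (real CARD('m) - 1) * \<epsilon> powr ?e)"
    using shell_premeasure_le[OF s0, where 'm='m and 'n='n] by blast
  define p where "p = real CARD('m) - 1 - (\<tau> + 1) * ?e"
  have "real CARD('m) < (\<tau> + 1) * ?e" using e \<tau> by (simp add: pos_divide_less_eq mult.commute)
  then have p: "p < -1" by (simp add: p_def)
  have summand: "A * real N powr (real CARD('m) - 1) * (real N powr (- (\<tau> + 1))) powr ?e = A * real N powr p" for N
    unfolding p_def using powr_collect_exponents[of "real N" _ "\<tau> + 1" ?e] by (simp only: mult.assoc)
  have summ: "summable (\<lambda>N. A * real N powr p)" using p by (intro summable_mult) (simp add: summable_real_powr_iff)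
  have "((\<lambda>N. real N powr (- (\<tau> + 1))) \<longlongrightarrow> 0) sequentially"
    using \<tau> by (intro tendsto_neg_powr filterlim_real_sequentially) auto
  then have "eventually (\<lambda>N. real N powr (- (\<tau> + 1)) < \<delta> / D) sequentially"
    using \<delta> AD by (intro order_tendstoD(2)) auto
  then obtain N0 where N0: "\<And>N. N0 \<le> N \<Longrightarrow> real N powr (- (\<tau> + 1)) < \<delta> / D"
    unfolding eventually_sequentially by blast
  show "hausdorff_premeasure s \<delta> (W0 \<tau> :: (real ^ 'n ^ 'm) set) = 0"
  proof (rule ccontr)
    assume nz: "\<not> ?thesis"
    obtain b where b: "0 < b" "ennreal b < hausdorff_premeasure s \<delta> (W0 \<tau> :: (real ^ 'n ^ 'm) set)"
    proof -
      have "0 < hausdorff_premeasure s \<delta> (W0 \<tau> :: (real ^ 'n ^ 'm) set)" using nz by (simp add: zero_less_iff_neq_zero)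
      then obtain y where y: "0 < y" "y < hausdorff_premeasure s \<delta> (W0 \<tau> :: (real ^ 'n ^ 'm) set)" using dense by blast
      then have "y \<noteq> top" by auto
      then show ?thesis using y that by (cases y) auto
    qed
    obtain N1 where N1: "\<And>n. N1 \<le> n \<Longrightarrow> norm (\<Sum>i. A * real (i + n) powr p) < b"
      using suminf_exist_split[OF b(1) summ] by blast
    define k where "k = Suc (N0 + N1)"
    let ?S = "\<lambda>N. (\<Union>w\<in>(int_shell N :: (int ^ 'm) set). slab w (real N * real N powr (- (\<tau> + 1))) :: (real ^ 'n ^ 'm) set)"
    have "W0 \<tau> \<subseteq> (\<Union>i. ?S (i + k))"
    proof
      fix X :: "real ^ 'n ^ 'm" assume "X \<in> W0 \<tau>"
      then obtain R and q :: "int ^ 'm" where R: "k \<le> R" "q \<in> int_shell R" "X \<in> slab q (real R powr (- \<tau>))"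
        by (rule W0_in_far_shell)
      have "real R powr (- \<tau>) = real R powr 1 * real R powr (- (\<tau> + 1))" unfolding powr_add[symmetric] by simp
      also have "\<dots> = real R * real R powr (- (\<tau> + 1))" by simp
      finally have "X \<in> ?S R" using R by auto
      then have "X \<in> ?S ((R - k) + k)" using R(1) by simp
      then show "X \<in> (\<Union>i. ?S (i + k))" by blast
    qed
    then have "hausdorff_premeasure s \<delta> (W0 \<tau> :: (real ^ 'n ^ 'm) set) \<le> hausdorff_premeasure s \<delta> (\<Union>i. ?S (i + k))"
      by (rule hausdorff_premeasure_mono)
    also have "\<dots> \<le> (\<Sum>i. hausdorff_premeasure s \<delta> (?S (i + k)))" by (rule hausdorff_premeasure_UN_le)
    also have "\<dots> \<le> (\<Sum>i. ennreal (A * real (i + k) powr p))"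
    proof (intro suminf_le allI)
      fix i
      let ?N = "i + k"
      have N: "1 \<le> ?N" "N0 \<le> ?N" by (auto simp: k_def)
      have "real ?N powr (- (\<tau> + 1)) \<le> 1"
        using N(1) \<tau> powr_mono[of "- (\<tau> + 1)" 0 "real ?N"] by simp
      moreover have "D * real ?N powr (- (\<tau> + 1)) \<le> \<delta>"
        using N0[OF N(2)] AD by (simp add: pos_less_divide_eq mult.commute)
      moreover have "0 < real ?N powr (- (\<tau> + 1))" using N(1) by simp
      ultimately have "hausdorff_premeasure s \<delta> (?S ?N) \<le> ennreal (A * real ?N powr (real CARD('m) - 1) * (real ?N powr (- (\<tau> + 1))) powr ?e)"
        using N(1) by (intro shell)
      then show "hausdorff_premeasure s \<delta> (?S ?N) \<le> ennreal (A * real ?N powr p)" unfolding summand .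
    qed auto
    also have "\<dots> = ennreal (\<Sum>i. A * real (i + k) powr p)"
    proof (rule suminf_ennreal2)
      show "summable (\<lambda>i. A * real (i + k) powr p)" using summ summable_iff_shift[of "\<lambda>N. A * real N powr p" k] by simp
    qed (use AD in auto)
    also have "\<dots> \<le> ennreal b"
    proof (rule ennreal_leI)
      have "norm (\<Sum>i. A * real (i + k) powr p) < b" by (rule N1) (simp add: k_def)
      then show "(\<Sum>i. A * real (i + k) powr p) \<le> b" by simp
    qed
    finally show False using b(2) by simp
  qed
qed

text \<open>Here all slabs have the same norm \<open>N\<close> and width \<open>m + 1\<close>, so \<open>\<epsilon> = (m + 1) / N\<close>, and the bound tends to \<open>0\<close>
as \<open>N\<close> grows.\<close>

lemma W0_null_by_single_shell:
  fixes \<tau> s :: real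
  assumes \<tau>: "0 < \<tau>" and s: "(real CARD('m) - 1) * (real CARD('n) + 1) < s"
  shows "hausdorff_measure s (W0 \<tau> :: (real ^ 'n ^ 'm) set) = 0"
  unfolding hausdorff_measure_eq_0_iff
proof (intro allI impI)
  fix \<delta> :: real assume \<delta>: "0 < \<delta>"
  let ?e = "s - (real CARD('m) - 1) * real CARD('n)"
  let ?c = "real (CARD('m) + 1)"
  have m1: "1 \<le> real CARD('m)" by (simp add: Suc_leI)
  have e: "real CARD('m) - 1 < ?e" using s by (simp add: algebra_simps)
  have s0: "0 < s" using s m1 by (smt (verit) mult_nonneg_nonneg of_nat_0_le_iff)
  obtain A D where AD: "0 < A" "0 < D" and shell: "\<And>N \<epsilon> \<delta>. \<lbrakk>1 \<le> N; 0 < \<epsilon>; \<epsilon> \<le> 1; D * \<epsilon> \<le> \<delta>\<rbrakk> \<Longrightarrow>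
      hausdorff_premeasure s \<delta> (\<Union>w\<in>(int_shell N :: (int ^ 'm) set). slab w (real N * \<epsilon>) :: (real ^ 'n ^ 'm) set)
      \<le> ennreal (A * real N powr (real CARD('m) - 1) * \<epsilon> powr ?e)"
    using shell_premeasure_le[OF s0, where 'm='m and 'n='n] by blast
  define g where "g N = A * ?c powr ?e * real N powr (real CARD('m) - 1 - ?e)" for N
  have "eventually (\<lambda>N. hausdorff_premeasure s \<delta> (W0 \<tau> :: (real ^ 'n ^ 'm) set) \<le> ennreal (g N)) sequentially"
    using eventually_ge_at_top[of "nat \<lceil>?c\<rceil>"] eventually_ge_at_top[of "nat \<lceil>D * ?c / \<delta>\<rceil>"] eventually_ge_at_top[of 1]
  proof eventually_elim
    fix N :: nat assume "nat \<lceil>?c\<rceil> \<le> N" "nat \<lceil>D * ?c / \<delta>\<rceil> \<le> N" and N: "1 \<le> N"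
    then have cN: "?c \<le> real N" "D * ?c / \<delta> \<le> real N" by linarith+
    have "W0 \<tau> \<subseteq> (\<Union>w\<in>(int_shell N :: (int ^ 'm) set). slab w (real N * (?c / real N)) :: (real ^ 'n ^ 'm) set)"
      using W0_meets_every_shell[OF _ \<tau> N] N by fastforce
    then have "hausdorff_premeasure s \<delta> (W0 \<tau> :: (real ^ 'n ^ 'm) set)
        \<le> hausdorff_premeasure s \<delta> (\<Union>w\<in>(int_shell N :: (int ^ 'm) set). slab w (real N * (?c / real N)) :: (real ^ 'n ^ 'm) set)"
      by (rule hausdorff_premeasure_mono)
    also have "\<dots> \<le> ennreal (A * real N powr (real CARD('m) - 1) * (?c / real N) powr ?e)"
    proof (intro shell N)
      show "D * (?c / real N) \<le> \<delta>" using cN(2) N \<delta> by (simp add: field_simps)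
      show "?c / real N \<le> 1" using cN(1) N by simp
    qed (use N in simp)
    also have "A * real N powr (real CARD('m) - 1) * (?c / real N) powr ?e = g N"
      unfolding g_def by (rule powr_collect_quotient)
    finally show "hausdorff_premeasure s \<delta> (W0 \<tau> :: (real ^ 'n ^ 'm) set) \<le> ennreal (g N)" .
  qed
  moreover have "((\<lambda>N. ennreal (g N)) \<longlongrightarrow> ennreal 0) sequentially"
  proof (intro tendsto_ennrealI)
    have "((\<lambda>N. real N powr (real CARD('m) - 1 - ?e)) \<longlongrightarrow> 0) sequentially"
      using e by (intro tendsto_neg_powr filterlim_real_sequentially) auto
    then show "(g \<longlongrightarrow> 0) sequentially" unfolding g_def by (rule tendsto_mult_right_zero)
  qed
  ultimately have "hausdorff_premeasure s \<delta> (W0 \<tau> :: (real ^ 'n ^ 'm) set) \<le> ennreal 0"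
    by (intro tendsto_lowerbound[of _ _ sequentially]) auto
  then show "hausdorff_premeasure s \<delta> (W0 \<tau> :: (real ^ 'n ^ 'm) set) = 0" by simp
qed

section \<open>Separated sets in the supremum norm\<close>

text \<open>Points are functions of which only the coordinates in \<open>J\<close> matter. This gives access to cubes of
dimension \<open>card J\<close> for an arbitrary finite set \<open>J\<close>, in particular for the type of row indices with one index
removed.\<close>

definition sup_ball :: "'a set \<Rightarrow> ('a \<Rightarrow> real) \<Rightarrow> real \<Rightarrow> ('a \<Rightarrow> real) set" where
  "sup_ball J c r = {x. \<forall>i\<in>J. \<bar>x i - c i\<bar> \<le> r}"

definition separated :: "'a set \<Rightarrow> real \<Rightarrow> ('a \<Rightarrow> real) set \<Rightarrow> bool" where
  "separated J \<sigma> A \<longleftrightarrow> (\<forall>x\<in>A. \<forall>y\<in>A. x \<noteq> y \<longrightarrow> (\<exists>i\<in>J. \<sigma> \<le> \<bar>x i - y i\<bar>))"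

lemma sup_ball_triangle:
  "x \<in> sup_ball J y r \<Longrightarrow> y \<in> sup_ball J z r' \<Longrightarrow> x \<in> sup_ball J z (r + r')"
  unfolding sup_ball_def
proof (intro CollectI ballI)
  fix i assume *: "x \<in> {x. \<forall>i\<in>J. \<bar>x i - y i\<bar> \<le> r}" "y \<in> {x. \<forall>i\<in>J. \<bar>x i - z i\<bar> \<le> r'}" "i \<in> J"
  then have "\<bar>x i - y i\<bar> \<le> r" "\<bar>y i - z i\<bar> \<le> r'" by blast+
  then show "\<bar>x i - z i\<bar> \<le> r + r'" by linarith
qed

lemma sup_ball_commute: "x \<in> sup_ball J y r \<longleftrightarrow> y \<in> sup_ball J x r"
  by (simp add: sup_ball_def abs_minus_commute)

lemma sup_ball_mono: "r \<le> r' \<Longrightarrow> sup_ball J c r \<subseteq> sup_ball J c r'"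
  unfolding sup_ball_def by (auto intro: order_trans)

lemma separated_subset: "separated J \<sigma> A \<Longrightarrow> B \<subseteq> A \<Longrightarrow> separated J \<sigma> B"
  unfolding separated_def by blast

text \<open>Rounding down to multiples of \<open>\<sigma>\<close> is injective on a \<open>\<sigma>\<close>-separated set.\<close>

lemma card_separated_le:
  assumes "finite J" "0 < \<sigma>" "0 \<le> r" "A \<subseteq> sup_ball J c r" "separated J \<sigma> A"
  shows "finite A" "real (card A) \<le> (2 * r / \<sigma> + 1) ^ card J"
proof -
  define f where "f x = (\<lambda>i\<in>J. \<lfloor>(x i - c i + r) / \<sigma>\<rfloor>)" for x :: "'a \<Rightarrow> real"
  let ?B = "PiE J (\<lambda>_. {0..\<lfloor>2 * r / \<sigma>\<rfloor>})"
  have img: "f ` A \<subseteq> ?B"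
  proof (intro image_subsetI PiE_I)
    fix x i assume "x \<in> A" "i \<in> J"
    then have "\<bar>x i - c i\<bar> \<le> r" using assms(4) by (auto simp: sup_ball_def)
    then have "0 \<le> (x i - c i + r) / \<sigma>" "(x i - c i + r) / \<sigma> \<le> 2 * r / \<sigma>"
      using assms(2) by (auto simp: divide_right_mono)
    then show "f x i \<in> {0..\<lfloor>2 * r / \<sigma>\<rfloor>}"
      using \<open>i \<in> J\<close> by (auto simp: f_def floor_mono)
  qed (auto simp: f_def)
  have inj: "inj_on f A"
  proof (rule inj_onI, rule ccontr)
    fix x y assume "x \<in> A" "y \<in> A" and eq: "f x = f y" and "x \<noteq> y"
    then obtain i where i: "i \<in> J" "\<sigma> \<le> \<bar>x i - y i\<bar>" using assms(5) by (auto simp: separated_def)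
    have "\<lfloor>(x i - c i + r) / \<sigma>\<rfloor> = \<lfloor>(y i - c i + r) / \<sigma>\<rfloor>"
      using fun_cong[OF eq, of i] i(1) by (simp add: f_def)
    then have "\<bar>(x i - c i + r) / \<sigma> - (y i - c i + r) / \<sigma>\<bar> < 1" by linarith
    then have "\<bar>(x i - y i) / \<sigma>\<bar> < 1" by (simp add: diff_divide_distrib[symmetric])
    then show False using i(2) assms(2) by (simp add: abs_divide)
  qed
  have fin: "finite ?B" using assms(1) by (intro finite_PiE) auto
  show "finite A" using finite_subset[OF img fin] inj by (rule finite_imageD)
  have "card A \<le> card ?B" using img inj fin by (metis card_image card_mono)
  also have "card ?B = nat (\<lfloor>2 * r / \<sigma>\<rfloor> + 1) ^ card J"
    using assms(1) by (simp add: card_PiE)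
  finally have "real (card A) \<le> real (nat (\<lfloor>2 * r / \<sigma>\<rfloor> + 1)) ^ card J"
    by (metis of_nat_le_iff of_nat_power)
  also have "\<dots> \<le> (2 * r / \<sigma> + 1) ^ card J"
  proof (rule power_mono)
    have "0 \<le> 2 * r / \<sigma>" using assms(2,3) by simp
    then show "real (nat (\<lfloor>2 * r / \<sigma>\<rfloor> + 1)) \<le> 2 * r / \<sigma> + 1" by linarith
  qed simp
  finally show "real (card A) \<le> (2 * r / \<sigma> + 1) ^ card J" .
qed

lemma card_le_card_image_mult:
  assumes "finite A" and "\<And>y. y \<in> f ` A \<Longrightarrow> real (card {x\<in>A. f x = y}) \<le> b"
  shows "real (card A) \<le> real (card (f ` A)) * b"
proof -
  have "card A = (\<Sum>y\<in>f ` A. card {x\<in>A. f x = y})"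
    using assms(1) sum.image_gen[of A "\<lambda>_. 1::nat" f] by simp
  then have "real (card A) = (\<Sum>y\<in>f ` A. real (card {x\<in>A. f x = y}))" by simp
  also have "\<dots> \<le> (\<Sum>y\<in>f ` A. b)" using assms(2) by (rule sum_mono)
  finally show ?thesis by simp
qed

section \<open>Well distributed rational points\<close>

lemma simultaneous_Dirichlet:
  fixes \<theta> :: "'a \<Rightarrow> real" and T :: nat
  assumes "finite J" "0 < T"
  obtains q :: nat and p :: "'a \<Rightarrow> int"
  where "1 \<le> q" "q \<le> T ^ card J" "\<And>i. i \<in> J \<Longrightarrow> \<bar>real q * \<theta> i - real_of_int (p i)\<bar> < 1 / real T"
proof -
  obtain h where h: "bij_betw h {..<card J} J"
    using assms(1) by (metis atLeast0LessThan ex_bij_betw_nat_finite)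
  obtain q p where q: "0 < q" "q \<le> int (T ^ card J)"
    and p: "\<And>k. k < card J \<Longrightarrow> \<bar>of_int q * (\<theta> \<circ> h) k - of_int (p k)\<bar> < 1 / T"
    using Dirichlet_approx_simult[OF assms(2), of "card J" "\<theta> \<circ> h"] by blast
  define h' where "h' = inv_into {..<card J} h"
  have h': "h' i < card J" "h (h' i) = i" if "i \<in> J" for i
    using bij_betw_inv_into_right[OF h that] bij_betw_apply[OF bij_betw_inv_into[OF h] that]
    unfolding h'_def by simp_all
  show ?thesis
  proof (rule that[of "nat q" "\<lambda>i. p (h' i)"])
    show "\<bar>real (nat q) * \<theta> i - real_of_int (p (h' i))\<bar> < 1 / real T" if "i \<in> J" for i
      using p[OF h'(1)[OF that]] h'(2)[OF that] q(1) by simp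
  qed (use q in \<open>auto simp: nat_le_iff\<close>)
qed

lemma maximal_separated_subset:
  assumes "finite R" "0 < \<sigma>"
  obtains S where "S \<subseteq> R" "separated J \<sigma> S" "\<And>x. x \<in> R \<Longrightarrow> \<exists>s\<in>S. x \<in> sup_ball J s \<sigma>"
proof -
  let ?F = "{S. S \<subseteq> R \<and> separated J \<sigma> S}"
  have "finite ?F" using assms(1) by (rule finite_subset[rotated, OF finite_Pow_iff[THEN iffD2]]) blast
  moreover have "{} \<in> ?F" by (simp add: separated_def)
  ultimately have "\<exists>S\<in>?F. \<forall>S'\<in>?F. S \<subseteq> S' \<longrightarrow> S = S'"
    by (intro finite_has_maximal) auto
  then obtain S where S: "S \<in> ?F" and max: "\<And>S'. S' \<in> ?F \<Longrightarrow> S \<subseteq> S' \<Longrightarrow> S = S'"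
    by (elim bexE) (rule that, assumption, metis)
  have "\<exists>s\<in>S. x \<in> sup_ball J s \<sigma>" if "x \<in> R" for x
  proof (rule ccontr)
    assume no: "\<not> ?thesis"
    have "separated J \<sigma> (insert x S)"
    proof -
      have far: "\<exists>i\<in>J. \<sigma> \<le> \<bar>x i - s i\<bar>" "\<exists>i\<in>J. \<sigma> \<le> \<bar>s i - x i\<bar>" if "s \<in> S" for s
        using no that unfolding sup_ball_def by (auto simp: not_le abs_minus_commute intro: less_imp_le)
      then show ?thesis using S unfolding separated_def by blast
    qed
    then have "x \<in> S" using S max[of "insert x S"] that by blast
    moreover have "x \<in> sup_ball J x \<sigma>" using assms(2) by (simp add: sup_ball_def)
    ultimately show False using no by blast
  qed
  then show ?thesis using that S by blast
qed

definition grid :: "'a set \<Rightarrow> ('a \<Rightarrow> real) \<Rightarrow> real \<Rightarrow> nat \<Rightarrow> ('a \<Rightarrow> real) set" where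
  "grid J a h M = PiE J (\<lambda>i. (\<lambda>t::nat. a i + h * real t) ` {..<M})"

lemma finite_grid: "finite J \<Longrightarrow> finite (grid J a h M)"
  unfolding grid_def by (intro finite_PiE) auto

lemma card_grid:
  assumes "finite J" "0 < h"
  shows "card (grid J a h M) = M ^ card J"
proof -
  have "card ((\<lambda>t::nat. a i + h * real t) ` {..<M}) = M" for i
    using assms(2) by (subst card_image) (auto intro!: inj_onI)
  then show ?thesis using assms(1) by (simp add: grid_def card_PiE)
qed

lemma grid_bounds:
  assumes "y \<in> grid J a h M" "i \<in> J" "0 < h"
  shows "a i \<le> y i" "y i \<le> a i + h * real M"
proof -
  have "y i \<in> (\<lambda>t::nat. a i + h * real t) ` {..<M}"
    using assms(1,2) unfolding grid_def by (rule PiE_mem)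
  then obtain t where t: "t < M" "y i = a i + h * real t" by blast
  then have "h * real t \<le> h * real M" "0 \<le> h * real t" using assms(3) by auto
  then show "a i \<le> y i" "y i \<le> a i + h * real M" using t by auto
qed

lemma separated_grid:
  assumes "0 < h"
  shows "separated J h (grid J a h M)"
  unfolding separated_def
proof (intro ballI impI)
  fix u v assume uv: "u \<in> grid J a h M" "v \<in> grid J a h M" "u \<noteq> v"
  then obtain i where i: "i \<in> J" "u i \<noteq> v i" unfolding grid_def by (metis PiE_ext)
  have "u i \<in> (\<lambda>t::nat. a i + h * real t) ` {..<M}" "v i \<in> (\<lambda>t::nat. a i + h * real t) ` {..<M}"
    using uv i(1) unfolding grid_def by (auto intro: PiE_mem)
  then obtain k l :: nat where kl: "u i = a i + h * real k" "v i = a i + h * real l" by blast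
  then have "k \<noteq> l" using i by auto
  then have "1 \<le> \<bar>real k - real l\<bar>" by linarith
  then have "h \<le> h * \<bar>real k - real l\<bar>" using assms by simp
  also have "\<dots> = \<bar>u i - v i\<bar>" using assms by (simp add: kl abs_mult flip: right_diff_distrib)
  finally show "\<exists>i\<in>J. h \<le> \<bar>u i - v i\<bar>" using i by blast
qed

text \<open>In \<open>many_separated_rationals\<close> denominators up to \<open>T ^ d\<close> are allowed, but those below
\<open>T ^ d / denom_ratio d\<close> are discarded. The value makes the discarded ones serve at most half of all grid
points.\<close>

definition denom_ratio :: "nat \<Rightarrow> real" where
  "denom_ratio d = 4 * 12 ^ d"

lemma denom_ratio_ge_1: "1 \<le> denom_ratio d"
  unfolding denom_ratio_def using one_le_power[of "12::real" d] by linarith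

text \<open>A cube of radius \<open>\<delta>\<close> has room for about \<open>(\<delta> / \<sigma>) ^ d\<close> points with separation \<open>\<sigma>\<close>; this is the fraction of
them that rational points are shown to realise.\<close>

definition packing_const :: "nat \<Rightarrow> real" where
  "packing_const d = (1 / (4 * (denom_ratio d + 2))) ^ d / 2"

text \<open>Take a very fine grid in the cube and attach to each grid point the rational point
\<open>p / q\<close>, \<open>q \<le> T ^ d\<close>, that Dirichlet's theorem provides at distance at most \<open>1 / (q T)\<close>. For a fixed
\<open>q\<close> the points \<open>p / q\<close> are \<open>1 / q\<close>-separated, so about \<open>(q \<delta>) ^ d\<close> of them are near the cube, and
each serves a proportion of about \<open>(1 / (q T \<delta>)) ^ d\<close> of the grid: every denominator serves a
proportion of at most about \<open>T ^ (- d)\<close>, except that for \<open>q < 1 / \<delta>\<close> a cruder bound is used, which a large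
\<open>T\<close> absorbs. Small denominators are therefore negligible. The remaining
rational points serve grid points within about \<open>\<sigma> = T ^ (- (d + 1))\<close>; so does a maximal \<open>\<sigma>\<close>-separated
subset of them, which must consequently have about \<open>(\<delta> / \<sigma>) ^ d\<close> elements.\<close>

lemma many_separated_rationals:
  fixes \<delta> :: real and x :: "'a \<Rightarrow> real"
  assumes J: "finite J" "J \<noteq> {}" and \<delta>: "0 < \<delta>"
    and T: "0 < T" "4 / \<delta> \<le> real T"
      "denom_ratio (card J) * (\<delta> + 1) ^ card J / (\<delta> * (2 * \<delta>) ^ card J) \<le> real T"
  obtains A where "finite A" "A \<subseteq> sup_ball J x (\<delta> / 2)" "separated J (1 / real T ^ (card J + 1)) A"
    "packing_const (card J) * \<delta> ^ card J * real T ^ (card J * (card J + 1)) \<le> real (card A)"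
    "\<And>y. y \<in> A \<Longrightarrow> \<exists>(q::nat) (p::'a \<Rightarrow> int). real T ^ card J / denom_ratio (card J) < real q \<and> q \<le> T ^ card J
        \<and> (\<forall>i\<in>J. y i = real_of_int (p i) / real q)"
proof -
  let ?d = "card J" and ?K = "denom_ratio (card J)"
  have K: "1 \<le> ?K" by (rule denom_ratio_ge_1)
  define \<sigma> where "\<sigma> = 1 / real T ^ (?d + 1)"
  have \<sigma>: "0 < \<sigma>" using T by (simp add: \<sigma>_def)
  have d: "1 \<le> ?d" using J by (simp add: Suc_leI card_gt_0_iff)
  obtain M :: nat where M: "\<delta> / (2 * \<sigma>) < real M" using reals_Archimedean2 by blast
  then have M0: "0 < M" using \<delta> \<sigma> by (metis divide_pos_pos less_trans mult_pos_pos of_nat_0_less_iff zero_less_numeral)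
  define h where "h = \<delta> / (2 * real M)"
  have h: "0 < h" "h \<le> \<sigma>" using M M0 \<delta> \<sigma> by (auto simp: h_def field_simps)
  have hT: "h * (real q * real T) \<le> 1" if "q \<le> T ^ ?d" for q :: nat
  proof -
    have "real q * real T \<le> real T ^ (?d + 1)"
      using that mult_right_mono[of "real q" "real (T ^ ?d)" "real T"] by (simp add: mult.commute)
    then have "h * (real q * real T) \<le> \<sigma> * real T ^ (?d + 1)"
      using h \<sigma> by (intro mult_mono) auto
    then show ?thesis using T by (simp add: \<sigma>_def)
  qed
  define Y where "Y = grid J (\<lambda>i. x i - \<delta> / 4) h M"
  have finY: "finite Y" and cardY: "card Y = M ^ ?d" and sepY: "separated J h Y"
    unfolding Y_def using J h by (simp_all add: finite_grid card_grid separated_grid)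
  have ballY: "Y \<subseteq> sup_ball J x (\<delta> / 4)"
  proof
    fix y assume y: "y \<in> Y"
    have "\<bar>y i - x i\<bar> \<le> \<delta> / 4" if iJ: "i \<in> J" for i
    proof -
      have "h * real M = \<delta> / 2" using M0 by (simp add: h_def)
      then have "x i - \<delta> / 4 \<le> y i" "y i \<le> x i - \<delta> / 4 + \<delta> / 2"
        using grid_bounds[OF y[unfolded Y_def] iJ] h by auto
      then show ?thesis by linarith
    qed
    then show "y \<in> sup_ball J x (\<delta> / 4)" by (simp add: sup_ball_def)
  qed
  have "\<exists>(q::nat) (p::'a \<Rightarrow> int). 1 \<le> q \<and> q \<le> T ^ ?d \<and> (\<forall>i\<in>J. \<bar>real q * y i - real_of_int (p i)\<bar> < 1 / real T)" for y
    using simultaneous_Dirichlet[OF J(1) T(1), of y] by metis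
  then obtain q :: "('a \<Rightarrow> real) \<Rightarrow> nat" and p :: "('a \<Rightarrow> real) \<Rightarrow> 'a \<Rightarrow> int"
    where q: "\<And>y. 1 \<le> q y" "\<And>y. q y \<le> T ^ ?d"
      and p: "\<And>y i. i \<in> J \<Longrightarrow> \<bar>real (q y) * y i - real_of_int (p y i)\<bar> < 1 / real T"
    by metis
  define z where "z y = (\<lambda>i\<in>J. real_of_int (p y i) / real (q y))" for y
  have yz: "y \<in> sup_ball J (z y) (1 / (real (q y) * real T))" for y
    unfolding sup_ball_def
  proof (intro CollectI ballI)
    fix i assume "i \<in> J"
    have q0: "0 < real (q y)" using q(1)[of y] by linarith
    have "y i - z y i = (real (q y) * y i - real_of_int (p y i)) / real (q y)"
      using q0 \<open>i \<in> J\<close> by (simp add: z_def field_simps)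
    then have "\<bar>y i - z y i\<bar> = \<bar>real (q y) * y i - real_of_int (p y i)\<bar> / real (q y)"
      using q0 by (simp add: abs_divide)
    also have "\<dots> \<le> (1 / real T) / real (q y)"
      using p[OF \<open>i \<in> J\<close>, of y] q0 by (intro divide_right_mono) auto
    finally show "\<bar>y i - z y i\<bar> \<le> 1 / (real (q y) * real T)" by (simp add: mult.commute)
  qed
  have ballz: "z y \<in> sup_ball J x (\<delta> / 2)" if "y \<in> Y" for y
  proof -
    have "1 \<le> real (q y)" using q(1)[of y] by simp
    then have "1 / (real (q y) * real T) \<le> 1 / real T"
      using T by (intro divide_left_mono) auto
    also have "\<dots> \<le> \<delta> / 4" using T \<delta> by (simp add: field_simps)
    finally have "1 / (real (q y) * real T) + \<delta> / 4 \<le> \<delta> / 2" by simp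
    moreover have "z y \<in> sup_ball J x (1 / (real (q y) * real T) + \<delta> / 4)"
      using yz[of y] ballY that sup_ball_commute[of y J "z y"] by (intro sup_ball_triangle[of _ _ y]) auto
    ultimately show ?thesis using sup_ball_mono by blast
  qed
  \<comment> \<open>A rational point attracts few grid points, so the grid points served by small
    denominators are a minority.\<close>
  have fibre: "real (card {y\<in>B. f y = w}) \<le> (2 * r / h + 1) ^ ?d"
    if "B \<subseteq> Y" "0 \<le> r" "\<And>y. y \<in> B \<Longrightarrow> y \<in> sup_ball J (f y) r" for B r w and f :: "('a \<Rightarrow> real) \<Rightarrow> ('a \<Rightarrow> real)"
    using that by (intro card_separated_le(2)[of J h r _ w] J h separated_subset[OF sepY]) auto
  \<comment> \<open>Grid points are called bad when their denominator is at most \<open>Q\<close>.\<close>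
  define Q where "Q = nat \<lfloor>real T ^ ?d / ?K\<rfloor>"
  have Q: "real Q \<le> real T ^ ?d / ?K" unfolding Q_def using K by (intro of_nat_floor) auto
  define bad where "bad = {y\<in>Y. q y \<le> Q}"
  have slice: "real (card {y\<in>Y. q y = k}) \<le> (3 / (real T * h)) ^ ?d * (\<delta> + 1 / real k) ^ ?d"
    if k: "1 \<le> k" "k \<le> T ^ ?d" for k
  proof -
    let ?B = "{y\<in>Y. q y = k}"
    have sepz: "separated J (1 / real k) (z ` ?B)"
      unfolding separated_def
    proof (intro ballI impI)
      fix u v assume "u \<in> z ` ?B" "v \<in> z ` ?B" "u \<noteq> v"
      then obtain a b where ab: "u = z a" "v = z b" "q a = k" "q b = k" by auto
      then obtain i where i: "i \<in> J" "p a i \<noteq> p b i"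
        using \<open>u \<noteq> v\<close> by (force simp: z_def)
      have "1 \<le> \<bar>real_of_int (p a i) - real_of_int (p b i)\<bar>" using i(2) by linarith
      then have "1 / real k \<le> \<bar>real_of_int (p a i) - real_of_int (p b i)\<bar> / real k"
        by (rule divide_right_mono) simp
      also have "\<dots> = \<bar>u i - v i\<bar>"
        using i ab k by (simp add: z_def abs_divide flip: diff_divide_distrib)
      finally show "\<exists>i\<in>J. 1 / real k \<le> \<bar>u i - v i\<bar>" using i by blast
    qed
    have "real (card ?B) \<le> real (card (z ` ?B)) * (2 * (1 / (real k * real T)) / h + 1) ^ ?d"
    proof (intro card_le_card_image_mult fibre)
      show "y \<in> sup_ball J (z y) (1 / (real k * real T))" if "y \<in> ?B" for y
        using yz[of y] that by simp
    qed (use finY in auto)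
    also have "\<dots> \<le> (2 * (\<delta> / 2) / (1 / real k) + 1) ^ ?d * (3 / (h * (real k * real T))) ^ ?d"
    proof (intro mult_mono)
      show "real (card (z ` ?B)) \<le> (2 * (\<delta> / 2) / (1 / real k) + 1) ^ ?d"
        using k \<delta> ballz by (intro card_separated_le(2)[OF J(1) _ _ _ sepz, of _ x]) auto
      have "1 \<le> 1 / (h * (real k * real T))"
        using hT[OF k(2)] h k T by (simp add: field_simps)
      then show "(2 * (1 / (real k * real T)) / h + 1) ^ ?d \<le> (3 / (h * (real k * real T))) ^ ?d"
        using h by (intro power_mono) (auto simp: field_simps)
    qed (use \<delta> h in auto)
    also have "\<dots> = (3 / (real T * h)) ^ ?d * (\<delta> + 1 / real k) ^ ?d"
      using k h T unfolding power_mult_distrib[symmetric] by (intro arg_cong[where f="\<lambda>t. t ^ ?d"]) (simp add: field_simps)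
    finally show ?thesis .
  qed
  have card_bad: "real (card bad) \<le> real (M ^ ?d) / 2"
  proof -
    have QT: "Q \<le> T ^ ?d"
    proof -
      have "real T ^ ?d / ?K \<le> real T ^ ?d / 1" using K by (intro divide_left_mono) auto
      then have "real Q \<le> real T ^ ?d" using Q by linarith
      then show ?thesis by (metis of_nat_le_iff of_nat_power)
    qed
    have "bad = (\<Union>k\<in>{1..Q}. {y\<in>Y. q y = k})" using q(1) by (auto simp: bad_def)
    then have "real (card bad) \<le> (\<Sum>k\<in>{1..Q}. real (card {y\<in>Y. q y = k}))"
      using card_UN_le[of "{1..Q}" "\<lambda>k. {y\<in>Y. q y = k}"] by (metis (mono_tags) finite_atLeastAtMost of_nat_le_iff of_nat_sum)
    also have "\<dots> \<le> (\<Sum>k\<in>{1..Q}. (3 / (real T * h)) ^ ?d * ((2 * \<delta>) ^ ?d + (if real k < 1 / \<delta> then (\<delta> + 1) ^ ?d else 0)))"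
    proof (rule sum_mono)
      fix k assume k: "k \<in> {1..Q}"
      then have "real (card {y\<in>Y. q y = k}) \<le> (3 / (real T * h)) ^ ?d * (\<delta> + 1 / real k) ^ ?d"
        using QT by (intro slice) auto
      also have "\<dots> \<le> (3 / (real T * h)) ^ ?d * ((2 * \<delta>) ^ ?d + (if real k < 1 / \<delta> then (\<delta> + 1) ^ ?d else 0))"
      proof (intro mult_left_mono)
        show "(\<delta> + 1 / real k) ^ ?d \<le> (2 * \<delta>) ^ ?d + (if real k < 1 / \<delta> then (\<delta> + 1) ^ ?d else 0)"
        proof (cases "real k < 1 / \<delta>")
          case True
          have "1 / real k \<le> 1" using k by auto
          then have "(\<delta> + 1 / real k) ^ ?d \<le> (\<delta> + 1) ^ ?d"
            using \<delta> by (intro power_mono) auto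
          then show ?thesis using True \<delta> by (simp add: add_increasing)
        next
          case False
          have "1 / real k \<le> \<delta>" using False k \<delta> by (simp add: field_simps)
          then have "(\<delta> + 1 / real k) ^ ?d \<le> (2 * \<delta>) ^ ?d"
            using \<delta> by (intro power_mono) auto
          then show ?thesis using False by simp
        qed
      qed (use h in auto)
      finally show "real (card {y\<in>Y. q y = k}) \<le> \<dots>" .
    qed
    also have "\<dots> = (3 / (real T * h)) ^ ?d * (real Q * (2 * \<delta>) ^ ?d + (\<Sum>k\<in>{1..Q}. if real k < 1 / \<delta> then (\<delta> + 1) ^ ?d else 0))"
      by (simp add: sum_distrib_left[symmetric] sum.distrib)
    also have "\<dots> \<le> (3 / (real T * h)) ^ ?d * (real T ^ ?d / ?K * (2 * \<delta>) ^ ?d + real T ^ ?d / ?K * (2 * \<delta>) ^ ?d)"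
    proof (intro mult_left_mono add_mono)
      have "(\<Sum>k\<in>{1..Q}. if real k < 1 / \<delta> then (\<delta> + 1) ^ ?d else 0) = (\<Sum>k\<in>{k\<in>{1..Q}. real k < 1 / \<delta>}. (\<delta> + 1) ^ ?d)"
        by (simp add: sum.If_cases Int_def conj_commute)
      also have "\<dots> = real (card {k\<in>{1..Q}. real k < 1 / \<delta>}) * (\<delta> + 1) ^ ?d" by simp
      also have "\<dots> \<le> (1 / \<delta>) * (\<delta> + 1) ^ ?d"
      proof (rule mult_right_mono)
        have "{k\<in>{1..Q}. real k < 1 / \<delta>} \<subseteq> {1..nat \<lfloor>1 / \<delta>\<rfloor>}" by (auto simp: le_nat_floor)
        then have "card {k\<in>{1..Q}. real k < 1 / \<delta>} \<le> nat \<lfloor>1 / \<delta>\<rfloor>"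
          using card_mono[of "{1..nat \<lfloor>1 / \<delta>\<rfloor>}"] by simp
        moreover have "0 \<le> 1 / \<delta>" using \<delta> by simp
        ultimately show "real (card {k\<in>{1..Q}. real k < 1 / \<delta>}) \<le> 1 / \<delta>" by linarith
      qed (use \<delta> in auto)
      also have "\<dots> \<le> real T * (2 * \<delta>) ^ ?d / ?K"
        using T(3) \<delta> K by (simp add: field_simps)
      also have "\<dots> \<le> real T ^ ?d * (2 * \<delta>) ^ ?d / ?K"
        using T(1) d \<delta> K by (intro divide_right_mono mult_right_mono) (auto intro: self_le_power)
      finally show "(\<Sum>k\<in>{1..Q}. if real k < 1 / \<delta> then (\<delta> + 1) ^ ?d else 0) \<le> real T ^ ?d / ?K * (2 * \<delta>) ^ ?d" by simp
      show "real Q * (2 * \<delta>) ^ ?d \<le> real T ^ ?d / ?K * (2 * \<delta>) ^ ?d"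
        using Q \<delta> by (intro mult_right_mono) auto
    qed (use h in auto)
    also have "\<dots> = 2 * ((3 / (real T * h)) ^ ?d * real T ^ ?d * (2 * \<delta>) ^ ?d) / ?K"
      by (simp add: field_simps)
    also have "(3 / (real T * h)) ^ ?d * real T ^ ?d * (2 * \<delta>) ^ ?d = (12 * real M) ^ ?d"
    proof -
      have "3 / (real T * h) * real T * (2 * \<delta>) = 12 * real M"
        using T(1) \<delta> M0 by (simp add: h_def)
      then show ?thesis by (metis power_mult_distrib)
    qed
    finally show ?thesis by (simp add: power_mult_distrib denom_ratio_def)
  qed
  define good where "good = Y - bad"
  have card_good: "real M ^ ?d / 2 \<le> real (card good)"
  proof -
    have "bad \<subseteq> Y" by (auto simp: bad_def)
    then have "card bad + card good = card Y"
      using finY by (simp add: good_def card_Diff_subset finite_subset card_mono)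
    then have "real (card bad) + real (card good) = real (M ^ ?d)"
      using cardY by (metis of_nat_add)
    then show ?thesis using card_bad by simp
  qed
  have qgood: "real T ^ ?d / ?K < real (q y)" if "y \<in> good" for y
  proof -
    have "Q < q y" using that by (auto simp: good_def bad_def)
    then show ?thesis unfolding Q_def by linarith
  qed
  have fing: "finite (z ` good)" using finY by (simp add: good_def)
  obtain A where A: "A \<subseteq> z ` good" "separated J \<sigma> A" "\<And>u. u \<in> z ` good \<Longrightarrow> \<exists>s\<in>A. u \<in> sup_ball J s \<sigma>"
    using maximal_separated_subset[OF fing \<sigma>, of J] by blast
  have "\<exists>s. s \<in> A \<and> z y \<in> sup_ball J s \<sigma>" if "y \<in> good" for y
    using A(3)[OF imageI[OF that]] by blast
  then obtain s where s: "\<And>y. y \<in> good \<Longrightarrow> s y \<in> A \<and> z y \<in> sup_ball J (s y) \<sigma>" by metis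
  have finA: "finite A" using finite_subset[OF A(1)] fing by blast
  have ys: "y \<in> sup_ball J (s y) ((?K + 1) * \<sigma>)" if "y \<in> good" for y
  proof -
    have q0: "0 < real (q y)" using q(1)[of y] by linarith
    have "1 / (real (q y) * real T) \<le> 1 / (real T ^ ?d / ?K * real T)"
      using qgood[OF that] T(1) q0 K by (intro divide_left_mono mult_right_mono mult_pos_pos) auto
    also have "\<dots> = ?K * \<sigma>" using T(1) by (simp add: \<sigma>_def mult.commute)
    finally have "1 / (real (q y) * real T) + \<sigma> \<le> (?K + 1) * \<sigma>" by (simp add: distrib_right)
    moreover have "y \<in> sup_ball J (s y) (1 / (real (q y) * real T) + \<sigma>)"
      using yz s that by (intro sup_ball_triangle) auto
    ultimately show ?thesis using sup_ball_mono by blast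
  qed
  have "real M ^ ?d / 2 \<le> real (card (s ` good)) * (2 * ((?K + 1) * \<sigma>) / h + 1) ^ ?d"
    using card_good
  proof (rule order_trans)
    show "real (card good) \<le> real (card (s ` good)) * (2 * ((?K + 1) * \<sigma>) / h + 1) ^ ?d"
      using finY ys \<sigma> K by (intro card_le_card_image_mult fibre) (auto simp: good_def)
  qed
  also have "\<dots> \<le> real (card A) * (2 * (?K + 2) * \<sigma> / h) ^ ?d"
  proof (intro mult_mono power_mono)
    show "real (card (s ` good)) \<le> real (card A)"
      using s finA by (auto intro!: card_mono)
    have "1 \<le> 2 * \<sigma> / h" using h by (simp add: field_simps)
    then have "2 * ((?K + 1) * \<sigma>) / h + 1 \<le> 2 * ((?K + 1) * \<sigma>) / h + 2 * \<sigma> / h" by simp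
    also have "\<dots> = 2 * (?K + 2) * \<sigma> / h" by (simp add: algebra_simps add_divide_distrib)
    finally show "2 * ((?K + 1) * \<sigma>) / h + 1 \<le> 2 * (?K + 2) * \<sigma> / h" .
  qed (use \<sigma> h K in auto)
  finally have mainB: "real M ^ ?d / 2 \<le> real (card A) * (2 * (?K + 2) * \<sigma> / h) ^ ?d" .
  define B where "B = (2 * (?K + 2) * \<sigma> / h) ^ ?d"
  have main: "real M ^ ?d / 2 \<le> real (card A) * B" unfolding B_def using mainB .
  have "packing_const ?d * \<delta> ^ ?d * real T ^ (?d * (?d + 1)) = (\<delta> / (4 * (?K + 2) * \<sigma>)) ^ ?d / 2"
  proof -
    have "\<delta> / (4 * (?K + 2) * \<sigma>) = 1 / (4 * (?K + 2)) * \<delta> * real T ^ (?d + 1)"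
      by (simp add: \<sigma>_def)
    then have "(\<delta> / (4 * (?K + 2) * \<sigma>)) ^ ?d = (1 / (4 * (?K + 2))) ^ ?d * \<delta> ^ ?d * real T ^ ((?d + 1) * ?d)"
      by (simp only: power_mult_distrib power_mult)
    then show ?thesis by (simp only: packing_const_def mult.commute[of ?d "?d + 1"])
  qed
  also have "\<dots> = real M ^ ?d / B / 2"
  proof -
    have "\<delta> / (4 * (?K + 2) * \<sigma>) = real M / (2 * (?K + 2) * \<sigma> / h)"
    proof -
      have "real M / (2 * (?K + 2) * \<sigma> / h) = (real M * h) / (2 * (?K + 2) * \<sigma>)" by simp
      also have "real M * h = \<delta> / 2" using M0 by (simp add: h_def)
      finally show ?thesis by simp
    qed
    then show ?thesis by (simp only: B_def power_divide)
  qed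
  also have "\<dots> \<le> real (card A)"
  proof -
    have "0 < B"
      unfolding B_def using \<sigma> h K by (intro zero_less_power divide_pos_pos mult_pos_pos) auto
    then have "real M ^ ?d / 2 / B \<le> real (card A)" using main by (simp only: pos_divide_le_eq)
    then show ?thesis by (simp only: divide_divide_eq_left mult.commute)
  qed
  finally have card: "packing_const ?d * \<delta> ^ ?d * real T ^ (?d * (?d + 1)) \<le> real (card A)" .
  show ?thesis
  proof (rule that[OF finA _ _ card])
    show "A \<subseteq> sup_ball J x (\<delta> / 2)" using A(1) ballz unfolding good_def by blast
    show "separated J (1 / real T ^ (?d + 1)) A" using A(2) unfolding \<sigma>_def .
    fix y assume "y \<in> A"
    then obtain u where "u \<in> good" "y = z u" using A(1) by blast
    then show "\<exists>(q::nat) (p::'a \<Rightarrow> int). real T ^ ?d / ?K < real q \<and> q \<le> T ^ ?d \<and> (\<forall>i\<in>J. y i = real_of_int (p i) / real q)"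
      using qgood[of u] q(2)[of u] by (intro exI[of _ "q u"] exI[of _ "p u"]) (simp add: z_def)
  qed
qed

lemma packing_const_pos: "0 < packing_const d"
  using denom_ratio_ge_1[of d] by (simp add: packing_const_def)

lemma packing_const_le_1: "packing_const d \<le> 1"
proof -
  have "(1 / (4 * (denom_ratio d + 2))) ^ d \<le> 1"
    using denom_ratio_ge_1[of d] by (intro power_le_one) auto
  then show ?thesis by (simp add: packing_const_def)
qed

lemma eventually_powr_ge:
  assumes "0 < a"
  shows "eventually (\<lambda>T::nat. B \<le> real T powr a) sequentially"
proof -
  have "filterlim (\<lambda>T::nat. real T powr a) at_top sequentially"
    using assms by real_asymp
  then show ?thesis by (simp add: filterlim_at_top)
qed

text \<open>One stage of the Cantor construction: each point of \<open>P\<close> receives the same number \<open>N\<close> of children, rational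
points from \<open>many_separated_rationals\<close> with a parameter \<open>T\<close> that is large in terms of the previous stage.
The new radius is \<open>\<delta>' = T powr (- d (\<tau> + 1))\<close>, which is at most \<open>q powr (- (\<tau> + 1))\<close> for \<open>q \<le> T ^ d\<close>. The
hypothesis \<open>\<tau> > 1 / d\<close> makes \<open>\<delta>'\<close> small compared with the separation \<open>\<sigma>\<close> of the children, and
\<open>s < (d + 1) / (\<tau> + 1)\<close> makes the total number of points at least \<open>\<delta>' powr (- s)\<close>.\<close>

lemma refinement_step:
  fixes \<delta> s \<tau> :: real and L :: nat and P :: "('a \<Rightarrow> real) set"
  assumes J: "finite J" "J \<noteq> {}" and \<tau>: "1 / real (card J) < \<tau>"
    and s: "0 < s" "s < (real (card J) + 1) / (\<tau> + 1)"
    and \<delta>: "0 < \<delta>" and P: "finite P" "P \<noteq> {}" "separated J (8 * \<delta>) P"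
  obtains ch :: "('a \<Rightarrow> real) \<Rightarrow> ('a \<Rightarrow> real) set" and \<delta>' \<sigma> :: real and N :: nat
  where "0 < \<delta>'" "\<delta>' \<le> \<delta> / 2" "0 < \<sigma>" "0 < N"
    "packing_const (card J) / 2 * (\<delta> / \<sigma>) ^ card J \<le> real N"
    "1 \<le> \<delta>' powr s * real (card (\<Union>(ch ` P)))"
    "separated J (8 * \<delta>') (\<Union>(ch ` P))"
    "\<And>x. x \<in> P \<Longrightarrow> finite (ch x) \<and> card (ch x) = N \<and> ch x \<subseteq> sup_ball J x (\<delta> / 2) \<and> separated J \<sigma> (ch x)"
    "card (\<Union>(ch ` P)) = N * card P"
    "\<And>y. y \<in> \<Union>(ch ` P) \<Longrightarrow> \<exists>(q::nat) (p::'a \<Rightarrow> int). L < q \<and> \<delta>' \<le> real q powr (- (\<tau> + 1)) \<and> (\<forall>i\<in>J. y i = real_of_int (p i) / real q)"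
proof -
  let ?d = "card J" and ?c = "packing_const (card J)" and ?K = "denom_ratio (card J)"
  have d: "1 \<le> ?d" using J by (simp add: Suc_leI card_gt_0_iff)
  have \<tau>0: "0 < \<tau>" using \<tau> by (rule less_trans[rotated]) (use d in simp)
  have \<tau>d: "1 < real ?d * \<tau>" using \<tau> d by (simp add: field_simps)
  define a where "a = real ?d * (1 + \<tau>)"
  define b where "b = real (?d * (?d + 1)) - a * s"
  have a: "real ?d + 1 < a" using \<tau>d by (simp add: a_def algebra_simps)
  have b: "0 < b"
  proof -
    have "s * (\<tau> + 1) < real ?d + 1" using s(2) \<tau>0 by (simp add: pos_less_divide_eq)
    then have "real ?d * (s * (\<tau> + 1)) < real ?d * (real ?d + 1)" using d by simp
    then show ?thesis by (simp add: b_def a_def algebra_simps)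
  qed
  have c: "0 < ?c" by (rule packing_const_pos)
  have "eventually (\<lambda>T::nat. 0 < T \<and> 4 / \<delta> \<le> real T powr 1
      \<and> ?K * (\<delta> + 1) ^ ?d / (\<delta> * (2 * \<delta>) ^ ?d) \<le> real T powr 1
      \<and> ?K * real L \<le> real T powr real ?d
      \<and> 2 / \<delta> \<le> real T powr a
      \<and> 8 \<le> real T powr (a - (real ?d + 1))
      \<and> 1 / (?c * \<delta> ^ ?d) \<le> real T powr real (?d * (?d + 1))
      \<and> 2 / (?c * \<delta> ^ ?d) \<le> real T powr b) sequentially"
  proof (intro eventually_conj eventually_powr_ge eventually_gt_at_top)
    show "0 < real (?d * (?d + 1))" "0 < real ?d" using d by (simp_all only: of_nat_0_less_iff) auto
  qed (use a b in auto)
  \<comment> \<open>The conditions on \<open>T\<close> are, in order: the hypotheses of \<open>many_separated_rationals\<close>, denominators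
    above \<open>L\<close>, \<open>\<delta>' \<le> \<delta> / 2\<close>, \<open>8 * \<delta>' \<le> \<sigma>\<close>, at least one child, and the mass condition.\<close>
  then obtain T :: nat where "0 < T \<and> 4 / \<delta> \<le> real T powr 1
      \<and> ?K * (\<delta> + 1) ^ ?d / (\<delta> * (2 * \<delta>) ^ ?d) \<le> real T powr 1
      \<and> ?K * real L \<le> real T powr real ?d
      \<and> 2 / \<delta> \<le> real T powr a
      \<and> 8 \<le> real T powr (a - (real ?d + 1))
      \<and> 1 / (?c * \<delta> ^ ?d) \<le> real T powr real (?d * (?d + 1))
      \<and> 2 / (?c * \<delta> ^ ?d) \<le> real T powr b"
    using eventually_happens' sequentially_bot by blast
  then have T: "0 < T" "4 / \<delta> \<le> real T" "?K * (\<delta> + 1) ^ ?d / (\<delta> * (2 * \<delta>) ^ ?d) \<le> real T"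
      "?K * real L \<le> real T ^ ?d" "2 / \<delta> \<le> real T powr a" "8 \<le> real T powr (a - (real ?d + 1))"
      "1 / (?c * \<delta> ^ ?d) \<le> real T ^ (?d * (?d + 1))" "2 / (?c * \<delta> ^ ?d) \<le> real T powr b"
    by (auto simp only: powr_realpow of_nat_0_less_iff powr_one of_nat_0_le_iff)
  define \<delta>' where "\<delta>' = real T powr (- a)"
  define \<sigma> where "\<sigma> = 1 / real T ^ (?d + 1)"
  define bound where "bound = ?c * \<delta> ^ ?d * real T ^ (?d * (?d + 1))"
  define N where "N = nat \<lfloor>bound\<rfloor>"
  have cd: "0 < ?c * \<delta> ^ ?d" using c \<delta> by simp
  have bound1: "1 \<le> bound" using T(7) cd by (simp add: bound_def pos_divide_le_eq mult.commute)
  have N: "0 < N" "bound / 2 \<le> real N" "real N \<le> bound"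
  proof -
    have "real N = real_of_int \<lfloor>bound\<rfloor>" "1 \<le> \<lfloor>bound\<rfloor>" using bound1 by (auto simp: N_def)
    then show "0 < N" "bound / 2 \<le> real N" "real N \<le> bound" by linarith+
  qed
  have \<delta>'0: "0 < \<delta>'" using T(1) by (simp add: \<delta>'_def)
  have \<delta>'\<delta>: "\<delta>' \<le> \<delta> / 2"
    using T(1,5) \<delta> by (simp add: \<delta>'_def powr_minus field_simps)
  have \<sigma>0: "0 < \<sigma>" using T(1) by (simp add: \<sigma>_def)
  have \<sigma>\<delta>': "8 * \<delta>' \<le> \<sigma>"
  proof -
    have "8 * real T powr (- a) \<le> real T powr (a - (real ?d + 1)) * real T powr (- a)"
      using T(6) by (intro mult_right_mono) auto
    also have "\<dots> = real T powr (- real (?d + 1))" by (simp add: algebra_simps flip: powr_add)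
    also have "\<dots> = \<sigma>" using T(1)
      by (simp only: powr_minus \<sigma>_def powr_realpow inverse_eq_divide of_nat_0_less_iff)
    finally show ?thesis by (simp add: \<delta>'_def)
  qed
  have "\<exists>A. finite A \<and> card A = N \<and> A \<subseteq> sup_ball J x (\<delta> / 2) \<and> separated J \<sigma> A \<and>
      (\<forall>y\<in>A. \<exists>(q::nat) (p::'a \<Rightarrow> int). L < q \<and> \<delta>' \<le> real q powr (- (\<tau> + 1)) \<and> (\<forall>i\<in>J. y i = real_of_int (p i) / real q))" for x
  proof -
    obtain A where A: "finite A" "A \<subseteq> sup_ball J x (\<delta> / 2)" "separated J \<sigma> A" "bound \<le> real (card A)"
      "\<And>y. y \<in> A \<Longrightarrow> \<exists>(q::nat) (p::'a \<Rightarrow> int). real T ^ ?d / ?K < real q \<and> q \<le> T ^ ?d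
        \<and> (\<forall>i\<in>J. y i = real_of_int (p i) / real q)"
      using many_separated_rationals[OF J \<delta> T(1,2,3), of x] unfolding \<sigma>_def bound_def by metis
    have "N \<le> card A" using N(3) A(4) by linarith
    then obtain A' where A': "A' \<subseteq> A" "card A' = N" "finite A'"
      using obtain_subset_with_card_n by metis
    have "\<exists>(q::nat) (p::'a \<Rightarrow> int). L < q \<and> \<delta>' \<le> real q powr (- (\<tau> + 1)) \<and> (\<forall>i\<in>J. y i = real_of_int (p i) / real q)"
      if y: "y \<in> A'" for y
    proof -
      obtain q :: nat and p :: "'a \<Rightarrow> int" where q: "real T ^ ?d / ?K < real q" "q \<le> T ^ ?d"
        and p: "\<forall>i\<in>J. y i = real_of_int (p i) / real q"
        using A(5) A'(1) y by blast
      have K: "0 < ?K" using denom_ratio_ge_1[of ?d] by linarith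
      have "real L \<le> real T ^ ?d / ?K" using T(4) K by (simp add: pos_le_divide_eq mult.commute)
      then have L: "L < q" using q(1) by linarith
      have "\<delta>' = (real T powr real ?d) powr (- (\<tau> + 1))"
        by (simp add: \<delta>'_def a_def powr_powr algebra_simps)
      also have "\<dots> = real (T ^ ?d) powr (- (\<tau> + 1))" using T(1) by (simp add: powr_realpow)
      also have "\<dots> \<le> real q powr (- (\<tau> + 1))"
        using q(2) L \<tau>0 by (intro powr_mono2') (auto simp flip: of_nat_power)
      finally show ?thesis using L p by blast
    qed
    then show ?thesis using A A' separated_subset by (intro exI[of _ A']) blast
  qed
  then obtain ch :: "('a \<Rightarrow> real) \<Rightarrow> ('a \<Rightarrow> real) set" where ch: "\<And>x. finite (ch x)" "\<And>x. card (ch x) = N"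
    "\<And>x. ch x \<subseteq> sup_ball J x (\<delta> / 2)" "\<And>x. separated J \<sigma> (ch x)"
    and rat: "\<And>x y. y \<in> ch x \<Longrightarrow> \<exists>(q::nat) (p::'a \<Rightarrow> int). L < q \<and> \<delta>' \<le> real q powr (- (\<tau> + 1)) \<and> (\<forall>i\<in>J. y i = real_of_int (p i) / real q)"
    by metis
  \<comment> \<open>Children of different points inherit the separation \<open>8 * \<delta>\<close> up to twice \<open>\<delta> / 2\<close>.\<close>
  have apart: "\<exists>i\<in>J. 7 * \<delta> \<le> \<bar>y i - y' i\<bar>"
    if "x \<in> P" "x' \<in> P" "x \<noteq> x'" "y \<in> ch x" "y' \<in> ch x'" for x x' y y'
  proof -
    obtain i where i: "i \<in> J" "8 * \<delta> \<le> \<bar>x i - x' i\<bar>"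
      using P(3) \<open>x \<in> P\<close> \<open>x' \<in> P\<close> \<open>x \<noteq> x'\<close> unfolding separated_def by blast
    have "\<bar>y i - x i\<bar> \<le> \<delta> / 2" "\<bar>y' i - x' i\<bar> \<le> \<delta> / 2"
      using ch(3)[of x] ch(3)[of x'] that i(1) by (auto simp: sup_ball_def)
    then show ?thesis using i by (intro bexI[of _ i]) linarith+
  qed
  have card: "card (\<Union>(ch ` P)) = N * card P"
  proof -
    have "card (\<Union>x\<in>P. ch x) = (\<Sum>x\<in>P. card (ch x))"
    proof (rule card_UN_disjoint[OF P(1)])
      show "\<forall>x\<in>P. \<forall>x'\<in>P. x \<noteq> x' \<longrightarrow> ch x \<inter> ch x' = {}"
        using apart \<delta> by (fastforce simp: disjoint_iff)
    qed (use ch in auto)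
    then show ?thesis using ch(2) by simp
  qed
  show ?thesis
  proof (rule that[of \<delta>' \<sigma> N ch])
    have "?c / 2 * (\<delta> / \<sigma>) ^ ?d = bound / 2"
      by (simp only: \<sigma>_def bound_def mult.commute[of ?d "?d + 1"] power_mult power_divide power_one) simp
    then show "?c / 2 * (\<delta> / \<sigma>) ^ ?d \<le> real N" using N(2) by simp
    have "1 \<le> ?c * \<delta> ^ ?d / 2 * real T powr b"
      using T(8) cd by (simp add: pos_divide_le_eq mult.commute)
    also have "\<dots> = \<delta>' powr s * (bound / 2)"
    proof -
      have "real T powr b = real T powr real (?d * (?d + 1)) * real T powr (- a * s)"
        by (simp add: b_def flip: powr_add)
      then have "real T powr b = real T ^ (?d * (?d + 1)) * \<delta>' powr s"
        using T(1) by (simp only: \<delta>'_def powr_powr powr_realpow of_nat_0_less_iff)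
      then show ?thesis by (simp add: bound_def)
    qed
    also have "\<dots> \<le> \<delta>' powr s * real (card (\<Union>(ch ` P)))"
    proof (rule mult_left_mono)
      have "1 \<le> card P" using P by (simp add: Suc_leI card_gt_0_iff)
      then have "N \<le> N * card P" by simp
      then have "N \<le> card (\<Union>(ch ` P))" unfolding card .
      then show "bound / 2 \<le> real (card (\<Union>(ch ` P)))" using N(2) by linarith
    qed simp
    finally show "1 \<le> \<delta>' powr s * real (card (\<Union>(ch ` P)))" .
    show "separated J (8 * \<delta>') (\<Union>(ch ` P))"
      unfolding separated_def
    proof (intro ballI impI)
      fix y y' assume "y \<in> \<Union>(ch ` P)" "y' \<in> \<Union>(ch ` P)" "y \<noteq> y'"
      then obtain x x' where x: "x \<in> P" "x' \<in> P" "y \<in> ch x" "y' \<in> ch x'" by blast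
      show "\<exists>i\<in>J. 8 * \<delta>' \<le> \<bar>y i - y' i\<bar>"
      proof (cases "x = x'")
        case True
        then obtain i where "i \<in> J" "\<sigma> \<le> \<bar>y i - y' i\<bar>"
          using ch(4)[of x] x \<open>y \<noteq> y'\<close> unfolding separated_def by blast
        then show ?thesis using \<sigma>\<delta>' by (intro bexI[of _ i]) linarith+
      next
        case False
        then obtain i where "i \<in> J" "7 * \<delta> \<le> \<bar>y i - y' i\<bar>" using apart x by blast
        then show ?thesis using \<delta>'\<delta> \<delta> by (intro bexI[of _ i]) linarith+
      qed
    qed
  qed (use \<delta>'0 \<delta>'\<delta> \<sigma>0 N(1) ch card rat in blast)+
qed

section \<open>A Cantor set of well approximable points\<close>

text \<open>The transition from stage \<open>k\<close> to the next one; the existential part records the family of children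
from which the new points arise, with their separation and their common number.\<close>

definition refines :: "'a set \<Rightarrow> real \<Rightarrow> nat \<Rightarrow> ('a \<Rightarrow> real) set \<times> real \<Rightarrow> ('a \<Rightarrow> real) set \<times> real \<Rightarrow> bool" where
  "refines J \<tau> k = (\<lambda>(P, \<delta>) (P', \<delta>'). \<delta>' \<le> \<delta> / 2 \<and>
     (\<exists>ch \<sigma> N. P' = \<Union>(ch ` P) \<and> 0 < \<sigma> \<and> 0 < N
       \<and> packing_const (card J) / 2 * (\<delta> / \<sigma>) ^ card J \<le> real N
       \<and> (\<forall>x\<in>P. finite (ch x) \<and> card (ch x) = N \<and> ch x \<subseteq> sup_ball J x (\<delta> / 2) \<and> separated J \<sigma> (ch x))
       \<and> card P' = N * card P)
     \<and> (\<forall>y\<in>P'. \<exists>(q::nat) (p::'a \<Rightarrow> int). k < q \<and> \<delta>' \<le> real q powr (- (\<tau> + 1)) \<and> (\<forall>i\<in>J. y i = real_of_int (p i) / real q)))"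

text \<open>The last conjunct says that a single point carries at most the mass \<open>\<delta> powr s\<close>. The factor \<open>8\<close> in the
separation ensures that a cube of radius comparable to \<open>\<delta>\<close> sees the children of one point only.\<close>

definition admissible :: "'a set \<Rightarrow> real \<Rightarrow> ('a \<Rightarrow> real) set \<times> real \<Rightarrow> bool" where
  "admissible J s = (\<lambda>(P, \<delta>). 0 < \<delta> \<and> finite P \<and> P \<noteq> {} \<and> separated J (8 * \<delta>) P \<and> 1 \<le> \<delta> powr s * real (card P))"

lemma admissible_refinement_exists:
  assumes J: "finite J" "J \<noteq> {}" and \<tau>: "1 / real (card J) < \<tau>"
    and s: "0 < s" "s < (real (card J) + 1) / (\<tau> + 1)" and X: "admissible J s X"
  shows "\<exists>Y. admissible J s Y \<and> refines J \<tau> k X Y"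
proof -
  obtain P \<delta> where X_eq: "X = (P, \<delta>)" by (cases X)
  have P: "0 < \<delta>" "finite P" "P \<noteq> {}" "separated J (8 * \<delta>) P"
    using X by (simp_all add: X_eq admissible_def)
  from refinement_step[OF J \<tau> s P, of k] obtain ch \<delta>' \<sigma> N
    where *: "0 < \<delta>'" "\<delta>' \<le> \<delta> / 2" "0 < \<sigma>" "0 < N"
    "packing_const (card J) / 2 * (\<delta> / \<sigma>) ^ card J \<le> real N"
    "1 \<le> \<delta>' powr s * real (card (\<Union>(ch ` P)))"
    "separated J (8 * \<delta>') (\<Union>(ch ` P))"
    "\<And>x. x \<in> P \<Longrightarrow> finite (ch x) \<and> card (ch x) = N \<and> ch x \<subseteq> sup_ball J x (\<delta> / 2) \<and> separated J \<sigma> (ch x)"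
    "card (\<Union>(ch ` P)) = N * card P"
    "\<And>y. y \<in> \<Union>(ch ` P) \<Longrightarrow> \<exists>(q::nat) (p::'a \<Rightarrow> int). k < q \<and> \<delta>' \<le> real q powr (- (\<tau> + 1)) \<and> (\<forall>i\<in>J. y i = real_of_int (p i) / real q)"
    by metis
  have "finite (\<Union>(ch ` P))" "\<Union>(ch ` P) \<noteq> {}"
  proof -
    show "finite (\<Union>(ch ` P))" using P *(8) by blast
    have "card (\<Union>(ch ` P)) \<noteq> 0" unfolding *(9) using *(4) P by simp
    then show "\<Union>(ch ` P) \<noteq> {}" by force
  qed
  then have "admissible J s (\<Union>(ch ` P), \<delta>')" using * by (simp add: admissible_def)
  moreover have "refines J \<tau> k X (\<Union>(ch ` P), \<delta>')"
    unfolding refines_def X_eq prod.case using * by blast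
  ultimately show ?thesis by blast
qed

text \<open>The cubes of radius \<open>\<delta> k\<close> around the points of \<open>P k\<close> decrease to a set of points that are well approximable
by the rational points of every stage. The count is the Frostman bound of this set: the
proportion \<open>dens k c r\<close> of points of stage \<open>k\<close> in a cube of radius \<open>r\<close> is compared with that of the first stage
\<open>j\<close> for which \<open>\<delta> j \<le> r\<close>, because all points have equally many descendants and these stay within \<open>\<delta> j\<close>.
At stage \<open>j\<close> the cube meets the children of at most one point, and their separation bounds their
number.\<close>

lemma Cantor_set_of_well_approximable_points:
  fixes J :: "'a set"
  assumes J: "finite J" "J \<noteq> {}" and \<tau>: "1 / real (card J) < \<tau>"
    and s: "0 < s" "s < (real (card J) + 1) / (\<tau> + 1)"
  obtains P :: "nat \<Rightarrow> ('a \<Rightarrow> real) set" and \<delta> :: "nat \<Rightarrow> real" and C :: real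
  where "P 0 = {\<lambda>_. 0}" "\<delta> 0 = 1" "\<And>k. 0 < \<delta> k" "\<And>k. \<delta> (Suc k) \<le> \<delta> k / 2"
    "\<And>k. finite (P k)" "\<And>k. P k \<noteq> {}" "\<And>k. separated J (\<delta> k) (P k)"
    "\<And>k y. y \<in> P (Suc k) \<Longrightarrow> \<exists>x\<in>P k. y \<in> sup_ball J x (\<delta> k / 2)"
    "\<And>k y. y \<in> P (Suc k) \<Longrightarrow> \<exists>(q::nat) (p::'a \<Rightarrow> int). k < q \<and> \<delta> (Suc k) \<le> real q powr (- (\<tau> + 1)) \<and> (\<forall>i\<in>J. y i = real_of_int (p i) / real q)"
    "0 < C" "\<And>k c r. \<delta> k \<le> r \<Longrightarrow> real (card (P k \<inter> sup_ball J c r)) \<le> C * r powr s * real (card (P k))"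
proof -
  let ?d = "card J" and ?c = "packing_const (card J)"
  have d: "1 \<le> ?d" using J by (simp add: Suc_leI card_gt_0_iff)
  have \<tau>0: "0 < \<tau>" using \<tau> by (rule less_trans[rotated]) (use d in simp)
  have sd: "s \<le> real ?d"
  proof -
    have "1 < real ?d * \<tau>" using \<tau> d by (simp add: field_simps)
    then have "(real ?d + 1) / (\<tau> + 1) \<le> real ?d" using \<tau>0 by (simp add: field_simps)
    then show ?thesis using s by linarith
  qed
  have "\<exists>X. admissible J s X \<and> X = ({\<lambda>_. 0}, 1)"
    by (simp add: admissible_def separated_def)
  then have "\<exists>X. \<forall>k. (admissible J s (X k) \<and> (k = 0 \<longrightarrow> X k = ({\<lambda>_. 0}, 1))) \<and> refines J \<tau> k (X k) (X (Suc k))"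
    using admissible_refinement_exists[OF J \<tau> s] by (intro dependent_nat_choice) auto
  then obtain X where X: "\<And>k. admissible J s (X k)" "X 0 = ({\<lambda>_. 0}, 1)" "\<And>k. refines J \<tau> k (X k) (X (Suc k))"
    by blast
  define P where "P k = fst (X k)" for k
  define \<delta> where "\<delta> k = snd (X k)" for k
  have X_eq: "X k = (P k, \<delta> k)" for k by (simp add: P_def \<delta>_def)
  have \<delta>0: "0 < \<delta> k" and finP: "finite (P k)" and neP: "P k \<noteq> {}" and sepP: "separated J (8 * \<delta> k) (P k)"
    and mass: "1 \<le> \<delta> k powr s * real (card (P k))" for k
    using X(1)[of k] by (simp_all add: admissible_def X_eq)
  have \<delta>dec: "\<delta> (Suc k) \<le> \<delta> k / 2" for k
    using X(3)[of k] unfolding refines_def X_eq by simp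
  have rat: "\<exists>(q::nat) (p::'a \<Rightarrow> int). k < q \<and> \<delta> (Suc k) \<le> real q powr (- (\<tau> + 1)) \<and> (\<forall>i\<in>J. y i = real_of_int (p i) / real q)"
    if "y \<in> P (Suc k)" for k y
    using X(3)[of k] that unfolding refines_def X_eq prod.case by blast
  have "\<exists>ch \<sigma> N. P (Suc k) = \<Union>(ch ` P k) \<and> 0 < \<sigma> \<and> 0 < N
       \<and> ?c / 2 * (\<delta> k / \<sigma>) ^ ?d \<le> real N
       \<and> (\<forall>x\<in>P k. finite (ch x) \<and> card (ch x) = N \<and> ch x \<subseteq> sup_ball J x (\<delta> k / 2) \<and> separated J \<sigma> (ch x))
       \<and> card (P (Suc k)) = N * card (P k)" for k
    using X(3)[of k] unfolding refines_def X_eq prod.case by blast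
  then obtain ch :: "nat \<Rightarrow> ('a \<Rightarrow> real) \<Rightarrow> ('a \<Rightarrow> real) set" and \<sigma> :: "nat \<Rightarrow> real" and N :: "nat \<Rightarrow> nat"
    where PSuc: "\<And>k. P (Suc k) = \<Union>(ch k ` P k)" and \<sigma>: "\<And>k. 0 < \<sigma> k" and N: "\<And>k. 0 < N k"
      "\<And>k. ?c / 2 * (\<delta> k / \<sigma> k) ^ ?d \<le> real (N k)"
      and ch: "\<And>k x. x \<in> P k \<Longrightarrow> finite (ch k x) \<and> card (ch k x) = N k \<and> ch k x \<subseteq> sup_ball J x (\<delta> k / 2) \<and> separated J (\<sigma> k) (ch k x)"
      and cardSuc: "\<And>k. card (P (Suc k)) = N k * card (P k)"
    by metis
  have cardP: "0 < real (card (P k))" for k using finP neP by (simp add: card_gt_0_iff)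
  define dens where "dens k c r = real (card (P k \<inter> sup_ball J c r)) / real (card (P k))" for k c r
  have dens_mono: "dens k c r \<le> dens k c r'" if "r \<le> r'" for k c r r'
    using that sup_ball_mono[OF that, of J c] finP cardP[of k]
    by (auto simp: dens_def intro!: divide_right_mono card_mono)
  have dens_le_1: "dens k c r \<le> 1" for k c r
    using finP cardP[of k] by (auto simp: dens_def divide_le_eq_1 intro!: card_mono)
  have parents: "P (Suc k) \<inter> sup_ball J c r = (\<Union>x\<in>P k \<inter> sup_ball J c (r + \<delta> k / 2). ch k x \<inter> sup_ball J c r)" for k c r
  proof -
    have "x \<in> sup_ball J c (r + \<delta> k / 2)" if "x \<in> P k" "y \<in> ch k x" "y \<in> sup_ball J c r" for x y
    proof -
      have "x \<in> sup_ball J y (\<delta> k / 2)" using ch[OF that(1)] that(2) by (auto simp: sup_ball_commute[of x])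
      from sup_ball_triangle[OF this that(3)] show ?thesis by (simp add: add.commute)
    qed
    then show ?thesis unfolding PSuc by blast
  qed
  \<comment> \<open>Passing to the next stage multiplies all counts by \<open>N k\<close> and moves points by at most \<open>\<delta> k / 2\<close>.\<close>
  have dens_Suc: "dens (Suc k) c r \<le> dens k c (r + \<delta> k / 2)" for k c r
  proof -
    let ?Q = "P k \<inter> sup_ball J c (r + \<delta> k / 2)"
    have "card (P (Suc k) \<inter> sup_ball J c r) \<le> (\<Sum>x\<in>?Q. card (ch k x \<inter> sup_ball J c r))"
      unfolding parents using finP by (intro card_UN_le) auto
    also have "\<dots> \<le> (\<Sum>x\<in>?Q. N k)"
    proof (rule sum_mono)
      fix x assume "x \<in> ?Q"
      then have "finite (ch k x)" "card (ch k x) = N k" using ch[of x k] by auto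
      then show "card (ch k x \<inter> sup_ball J c r) \<le> N k" by (metis card_mono inf_le1)
    qed
    finally have "real (card (P (Suc k) \<inter> sup_ball J c r)) \<le> real (card ?Q) * real (N k)"
      by (simp flip: of_nat_mult)
    then have "dens (Suc k) c r \<le> real (card ?Q) * real (N k) / real (card (P (Suc k)))"
      unfolding dens_def by (rule divide_right_mono) simp
    also have "\<dots> = dens k c (r + \<delta> k / 2)"
      using N(1)[of k] by (simp add: dens_def cardSuc)
    finally show ?thesis .
  qed
  have dens_anc: "dens (j + n) c r \<le> dens j c (r + \<delta> j - \<delta> (j + n))" for j n c r
  proof (induction n arbitrary: r)
    case (Suc n)
    have "dens (j + Suc n) c r \<le> dens (j + n) c (r + \<delta> (j + n) / 2)" using dens_Suc by simp
    also have "\<dots> \<le> dens j c (r + \<delta> (j + n) / 2 + \<delta> j - \<delta> (j + n))" by (rule Suc)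
    also have "\<dots> \<le> dens j c (r + \<delta> j - \<delta> (j + Suc n))"
      using \<delta>dec[of "j + n"] by (intro dens_mono) simp
    finally show ?case .
  qed simp
  define C where "C = 2 * 5 ^ ?d / ?c"
  have c: "0 < ?c" "?c \<le> 1" by (rule packing_const_pos packing_const_le_1)+
  have C: "5 ^ ?d \<le> C" "1 \<le> C"
  proof -
    have "5 ^ ?d * ?c \<le> 5 ^ ?d * 2" using c by (intro mult_left_mono) auto
    then show "5 ^ ?d \<le> C" using c by (simp add: C_def pos_le_divide_eq)
    then show "1 \<le> C" using one_le_power[of "5::real" ?d] by linarith
  qed
  \<comment> \<open>In the range between two consecutive radii: for \<open>r\<close> below the separation of the children only boundedly
    many points are met, and the mass of a point is controlled by admissibility; above it the
    separation bounds the count and \<open>s \<le> d\<close> turns the volume ratio into the power \<open>s\<close>.\<close>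
  have dens_scale: "dens (Suc j) c (2 * r) \<le> C * r powr s" if r: "\<delta> (Suc j) \<le> r" "r \<le> \<delta> j" for j c r
  proof -
    have r0: "0 < r" using r(1) \<delta>0[of "Suc j"] by linarith
    let ?Q = "P j \<inter> sup_ball J c (2 * r + \<delta> j / 2)"
    have one: "x = y" if "x \<in> ?Q" "y \<in> ?Q" for x y
    proof (rule ccontr)
      assume "x \<noteq> y"
      moreover have "x \<in> P j" "y \<in> P j" using that by auto
      ultimately obtain i where i: "i \<in> J" "8 * \<delta> j \<le> \<bar>x i - y i\<bar>"
        using sepP[of j] unfolding separated_def by blast
      have "\<bar>x i - c i\<bar> \<le> 2 * r + \<delta> j / 2" "\<bar>y i - c i\<bar> \<le> 2 * r + \<delta> j / 2"
        using that i(1) unfolding sup_ball_def by blast+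
      then show False using i r(2) \<delta>0[of j] by linarith
    qed
    have "real (card (P (Suc j) \<inter> sup_ball J c (2 * r))) \<le> (4 * r / \<sigma> j + 1) ^ ?d"
    proof (cases "?Q = {}")
      case True
      then show ?thesis unfolding parents using r0 \<sigma>[of j] by simp
    next
      case False
      then obtain x where xQ: "x \<in> ?Q" by blast
      have "y = x" if "y \<in> ?Q" for y using that xQ by (rule one)
      then have x: "?Q = {x}" using xQ by blast
      have "separated J (\<sigma> j) (ch j x \<inter> sup_ball J c (2 * r))"
        using ch[of x j] xQ separated_subset by blast
      then have "card (ch j x \<inter> sup_ball J c (2 * r)) \<le> (2 * (2 * r) / \<sigma> j + 1) ^ ?d"
        using card_separated_le(2)[OF J(1) \<sigma>[of j], of "2 * r" _ c] r0 by simp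
      then show ?thesis unfolding parents x by simp
    qed
    then have le: "dens (Suc j) c (2 * r) \<le> (4 * r / \<sigma> j + 1) ^ ?d / real (card (P (Suc j)))"
      unfolding dens_def by (rule divide_right_mono) simp
    show ?thesis
    proof (cases "r \<le> \<sigma> j")
      case True
      then have "(4 * r / \<sigma> j + 1) ^ ?d \<le> 5 ^ ?d"
        using r0 \<sigma>[of j] by (intro power_mono) (auto simp: field_simps)
      then have "dens (Suc j) c (2 * r) \<le> 5 ^ ?d / real (card (P (Suc j)))"
        using le cardP[of "Suc j"] by (meson divide_right_mono less_imp_le order_trans)
      also have "\<dots> \<le> 5 ^ ?d * \<delta> (Suc j) powr s"
        using mass[of "Suc j"] cardP[of "Suc j"] by (simp add: pos_divide_le_eq mult.assoc)
      also have "\<dots> \<le> C * r powr s"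
        using C r(1) s \<delta>0[of "Suc j"] by (intro mult_mono powr_mono2) auto
      finally show ?thesis .
    next
      case False
      then have "(4 * r / \<sigma> j + 1) ^ ?d \<le> (5 * r / \<sigma> j) ^ ?d"
        using r0 \<sigma>[of j] by (intro power_mono) (auto simp: field_simps)
      then have "dens (Suc j) c (2 * r) \<le> (5 * r / \<sigma> j) ^ ?d / real (card (P (Suc j)))"
        using le cardP[of "Suc j"] by (meson divide_right_mono less_imp_le order_trans)
      also have "\<dots> \<le> (5 * r / \<sigma> j) ^ ?d / (?c / 2 * (\<delta> j / \<sigma> j) ^ ?d * (1 / \<delta> j powr s))"
      proof (rule divide_left_mono)
        have "1 / \<delta> j powr s \<le> real (card (P j))"
          using mass[of j] \<delta>0[of j] by (simp add: pos_divide_le_eq mult.commute)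
        then show "?c / 2 * (\<delta> j / \<sigma> j) ^ ?d * (1 / \<delta> j powr s) \<le> real (card (P (Suc j)))"
          unfolding cardSuc of_nat_mult using N(2)[of j] by (intro mult_mono) auto
        show "0 < real (card (P (Suc j))) * (?c / 2 * (\<delta> j / \<sigma> j) ^ ?d * (1 / \<delta> j powr s))"
          using cardP[of "Suc j"] c \<delta>0[of j] \<sigma>[of j] by simp
      qed (use r0 \<sigma>[of j] in auto)
      also have "\<dots> = C * ((r / \<delta> j) ^ ?d * \<delta> j powr s)"
        using \<sigma>[of j] \<delta>0[of j] c by (simp add: C_def power_mult_distrib power_divide field_simps)
      also have "\<dots> \<le> C * r powr s"
      proof (rule mult_left_mono)
        have "(r / \<delta> j) ^ ?d = (r / \<delta> j) powr real ?d" using r0 \<delta>0[of j] by (simp add: powr_realpow)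
        also have "\<dots> \<le> (r / \<delta> j) powr s" using sd r r0 \<delta>0[of j] by (intro powr_mono') auto
        finally have "(r / \<delta> j) ^ ?d * \<delta> j powr s \<le> (r / \<delta> j) powr s * \<delta> j powr s"
          by (rule mult_right_mono) simp
        also have "\<dots> = r powr s" using r0 \<delta>0[of j] by (simp flip: powr_mult)
        finally show "(r / \<delta> j) ^ ?d * \<delta> j powr s \<le> r powr s" .
      qed (use C in auto)
      finally show ?thesis .
    qed
  qed
  have dens_final: "dens k c r \<le> C * r powr s" if r: "\<delta> k \<le> r" for k c r
  proof (cases "1 \<le> r")
    case True
    then have "1 * 1 \<le> C * r powr s" using C s by (intro mult_mono) (auto intro: ge_one_powr_ge_zero)
    then show ?thesis using dens_le_1[of k c r] by linarith
  next
    case False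
    define j where "j = (LEAST j. \<delta> j \<le> r)"
    have j: "\<delta> j \<le> r" "j \<le> k" unfolding j_def using r by (auto intro: LeastI Least_le)
    have "\<delta> 0 = 1" using X(2) by (simp add: X_eq)
    then have "j \<noteq> 0" using j(1) False by metis
    then obtain i where i: "j = Suc i" by (cases j) auto
    have "\<not> \<delta> i \<le> r" using not_less_Least[of i "\<lambda>j. \<delta> j \<le> r"] i by (simp add: j_def)
    have "dens k c r \<le> dens j c (r + \<delta> j - \<delta> k)"
      using dens_anc[of j "k - j" c r] j(2) by simp
    also have "\<dots> \<le> dens j c (2 * r)" using j(1) \<delta>0[of k] by (intro dens_mono) simp
    also have "\<dots> \<le> C * r powr s"
      unfolding i using \<open>\<not> \<delta> i \<le> r\<close> j(1) i by (intro dens_scale) auto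
    finally show ?thesis .
  qed
  show ?thesis
  proof (rule that[OF _ _ \<delta>0 \<delta>dec finP neP _ _ rat])
    show "P 0 = {\<lambda>_. 0}" "\<delta> 0 = 1" using X(2) by (simp_all add: X_eq)
    show "\<exists>x\<in>P k. y \<in> sup_ball J x (\<delta> k / 2)" if y: "y \<in> P (Suc k)" for k y
    proof -
      obtain x where x: "x \<in> P k" "y \<in> ch k x" using y unfolding PSuc by blast
      then show ?thesis using ch[OF x(1)] by blast
    qed
    show "separated J (\<delta> k) (P k)" for k
      unfolding separated_def
    proof (intro ballI impI)
      fix x y assume "x \<in> P k" "y \<in> P k" "x \<noteq> y"
      then obtain i where "i \<in> J" "8 * \<delta> k \<le> \<bar>x i - y i\<bar>" using sepP[of k] unfolding separated_def by blast
      then show "\<exists>i\<in>J. \<delta> k \<le> \<bar>x i - y i\<bar>" using \<delta>0[of k] by (intro bexI[of _ i]) linarith+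
    qed
    show "real (card (P k \<inter> sup_ball J c r)) \<le> C * r powr s * real (card (P k))" if "\<delta> k \<le> r" for k c r
      using dens_final[OF that, of c] cardP[of k] by (simp add: dens_def pos_divide_le_eq)
    show "0 < C" using C(2) by linarith
  qed
qed

section \<open>Matrices with a prescribed left kernel\<close>

text \<open>Row \<open>i0\<close> is chosen such that the vector with entry \<open>1\<close> at \<open>i0\<close> and entries \<open>y l\<close> elsewhere annihilates the
matrix from the left, while the other rows are given by \<open>g\<close>.\<close>

definition kernel_matrix :: "'m \<Rightarrow> ('m \<Rightarrow> real) \<Rightarrow> ('m \<times> 'n \<Rightarrow> real) \<Rightarrow> real ^ 'n ^ 'm" where
  "kernel_matrix i0 y g = (\<chi> i j. if i = i0 then - (\<Sum>l\<in>UNIV - {i0}. y l * g (l, j)) else g (i, j))"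

lemma kernel_matrix_row: "kernel_matrix i0 y g $ i0 $ j = - (\<Sum>l\<in>UNIV - {i0}. y l * g (l, j))"
  and kernel_matrix_other: "i \<noteq> i0 \<Longrightarrow> kernel_matrix i0 y g $ i $ j = g (i, j)"
  by (simp_all add: kernel_matrix_def)

text \<open>The free rows range over a box of this radius around \<open>1 / 4\<close> times distinct unit vectors. It is so small that
the rows remain uniformly linearly independent and the entries of the matrix stay below \<open>1 / 2\<close>.\<close>

definition row_radius :: "nat \<Rightarrow> real" where
  "row_radius m = 1 / (8 * (real m + 1))"

definition row_centre :: "('m \<Rightarrow> 'n) \<Rightarrow> 'm \<times> 'n \<Rightarrow> real" where
  "row_centre \<phi> = (\<lambda>(i, j). if j = \<phi> i then 1 / 4 else 0)"

lemma row_radius_bounds: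
  assumes "k \<le> m"
  shows "0 < row_radius m" "real k * row_radius m \<le> 1 / 8"
proof -
  show "0 < row_radius m" by (simp add: row_radius_def)
  have "real k \<le> real m + 1" using assms by simp
  then show "real k * row_radius m \<le> 1 / 8" by (simp add: row_radius_def field_simps)
qed

lemma near_centre_entries:
  assumes "g \<in> sup_ball (J \<times> UNIV) (row_centre \<phi>) \<eta>" "l \<in> J"
  shows "j \<noteq> \<phi> l \<Longrightarrow> \<bar>g (l, j)\<bar> \<le> \<eta>" "1 / 4 - \<eta> \<le> g (l, \<phi> l)" "\<bar>g (l, j)\<bar> \<le> \<eta> + (if j = \<phi> l then 1 / 4 else 0)"
proof -
  have *: "\<bar>g (l, j) - row_centre \<phi> (l, j)\<bar> \<le> \<eta>" for j using assms by (auto simp: sup_ball_def)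
  show "j \<noteq> \<phi> l \<Longrightarrow> \<bar>g (l, j)\<bar> \<le> \<eta>" using *[of j] by (simp add: row_centre_def)
  show "1 / 4 - \<eta> \<le> g (l, \<phi> l)" using *[of "\<phi> l"] by (simp add: row_centre_def)
  show "\<bar>g (l, j)\<bar> \<le> \<eta> + (if j = \<phi> l then 1 / 4 else 0)" using *[of j] by (auto simp: row_centre_def)
qed

lemma column_sum_le:
  fixes J :: "'m::finite set"
  assumes inj: "inj_on \<phi> J" and g: "g \<in> sup_ball (J \<times> UNIV) (row_centre \<phi>) (row_radius CARD('m))"
  shows "(\<Sum>l\<in>J. \<bar>g (l, j)\<bar>) \<le> 3 / 8"
proof -
  let ?\<eta> = "row_radius CARD('m)"
  have "(\<Sum>l\<in>J. \<bar>g (l, j)\<bar>) \<le> (\<Sum>l\<in>J. ?\<eta> + (if j = \<phi> l then 1 / 4 else 0))"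
    by (intro sum_mono near_centre_entries(3)[OF g])
  also have "\<dots> = real (card J) * ?\<eta> + (\<Sum>l\<in>J. if j = \<phi> l then 1 / 4 else 0)"
    by (simp add: sum.distrib)
  also have "\<dots> \<le> 1 / 8 + 1 / 4"
  proof (rule add_mono)
    show "real (card J) * ?\<eta> \<le> 1 / 8" by (intro row_radius_bounds card_mono) auto
    show "(\<Sum>l\<in>J. if j = \<phi> l then 1 / 4 else (0::real)) \<le> 1 / 4"
    proof (cases "j \<in> \<phi> ` J")
      case True
      then obtain l0 where l0: "l0 \<in> J" "j = \<phi> l0" by blast
      have "(\<Sum>l\<in>J. if j = \<phi> l then 1 / 4 else (0::real)) = (\<Sum>l\<in>J. if l = l0 then 1 / 4 else 0)"
        using l0 inj by (intro sum.cong) (auto simp: inj_on_def)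
      then show ?thesis using l0 by simp
    next
      case False
      then have "(\<Sum>l\<in>J. if j = \<phi> l then 1 / 4 else (0::real)) = 0" by (intro sum.neutral) auto
      then show ?thesis by simp
    qed
  qed
  finally show ?thesis by simp
qed

lemma kernel_matrix_in_unit_cube:
  fixes i0 :: "'m::finite" and \<phi> :: "'m \<Rightarrow> 'n::finite"
  assumes inj: "inj_on \<phi> (UNIV - {i0})" and y: "y \<in> sup_ball (UNIV - {i0}) (\<lambda>_. 0) 1"
    and g: "g \<in> sup_ball ((UNIV - {i0}) \<times> UNIV) (row_centre \<phi>) (row_radius CARD('m))"
  shows "kernel_matrix i0 y g \<in> unit_cube_matrices"
proof -
  have sum: "(\<Sum>l\<in>UNIV - {i0}. \<bar>g (l, j)\<bar>) \<le> 3 / 8" for j by (rule column_sum_le[OF inj g])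
  have "\<bar>kernel_matrix i0 y g $ i $ j\<bar> \<le> 1 / 2" for i j
  proof (cases "i = i0")
    case True
    have "\<bar>\<Sum>l\<in>UNIV - {i0}. y l * g (l, j)\<bar> \<le> (\<Sum>l\<in>UNIV - {i0}. \<bar>g (l, j)\<bar>)"
    proof (rule order_trans[OF sum_abs sum_mono])
      fix l assume "l \<in> UNIV - {i0}"
      then have "\<bar>y l\<bar> \<le> 1" using y by (simp add: sup_ball_def)
      then show "\<bar>y l * g (l, j)\<bar> \<le> \<bar>g (l, j)\<bar>" by (simp add: abs_mult mult_left_le_one_le)
    qed
    then show ?thesis using True sum[of j] by (simp add: kernel_matrix_row)
  next
    case False
    have "\<bar>g (i, j)\<bar> \<le> (\<Sum>l\<in>UNIV - {i0}. \<bar>g (l, j)\<bar>)"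
      using False by (intro member_le_sum) auto
    then show ?thesis using False sum[of j] by (simp add: kernel_matrix_other)
  qed
  then have "- 1 / 2 \<le> kernel_matrix i0 y g $ i $ j \<and> kernel_matrix i0 y g $ i $ j \<le> 1 / 2" for i j
    unfolding abs_le_iff by (metis minus_divide_left minus_le_iff)
  then show ?thesis by (simp only: unit_cube_matrices_def atLeastAtMost_iff mem_Collect_eq) blast
qed

text \<open>The free rows can be read off directly. For the direction, the difference of the rows \<open>i0\<close> determines
the combination of the free rows with coefficients \<open>y l - y' l\<close> up to an error of order \<open>r\<close>. In the column
\<open>\<phi> l0\<close> belonging to the largest coefficient, the row \<open>l0\<close> has an entry close to \<open>1 / 4\<close> and the contributions
of all other rows together are smaller.\<close>

lemma kernel_matrix_inverse_Lipschitz: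
  fixes i0 :: "'m::finite" and \<phi> :: "'m \<Rightarrow> 'n::finite"
  assumes inj: "inj_on \<phi> (UNIV - {i0})" and y': "y' \<in> sup_ball (UNIV - {i0}) (\<lambda>_. 0) 1"
    and g: "g \<in> sup_ball ((UNIV - {i0}) \<times> UNIV) (row_centre \<phi>) (row_radius CARD('m))"
    and r: "\<And>i j. \<bar>kernel_matrix i0 y g $ i $ j - kernel_matrix i0 y' g' $ i $ j\<bar> \<le> r"
  shows "g \<in> sup_ball ((UNIV - {i0}) \<times> UNIV) g' r"
    and "y \<in> sup_ball (UNIV - {i0}) y' (8 * real CARD('m) * r)"
proof -
  let ?J = "UNIV - {i0}" and ?\<eta> = "row_radius CARD('m)"
  have gg: "\<bar>g (l, j) - g' (l, j)\<bar> \<le> r" if "l \<in> ?J" for l j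
    using r[of l j] that by (simp add: kernel_matrix_other)
  then show "g \<in> sup_ball (?J \<times> UNIV) g' r" by (auto simp: sup_ball_def)
  show "y \<in> sup_ball ?J y' (8 * real CARD('m) * r)"
  proof (cases "?J = {}")
    case False
    define D where "D = Max ((\<lambda>l. \<bar>y l - y' l\<bar>) ` ?J)"
    have D: "\<bar>y l - y' l\<bar> \<le> D" if "l \<in> ?J" for l using that by (auto simp: D_def)
    have "D \<in> (\<lambda>l. \<bar>y l - y' l\<bar>) ` ?J" unfolding D_def using False by (intro Max_in) auto
    then obtain l0 where l0: "l0 \<in> ?J" "D = \<bar>y l0 - y' l0\<bar>" by blast
    define j where "j = \<phi> l0"
    have cJ: "real (card ?J) = real CARD('m) - 1" by (simp add: card_Diff_singleton of_nat_diff Suc_leI)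
    have r0: "0 \<le> r" using r[of i0 j] by linarith
    have "(\<Sum>l\<in>?J. (y l - y' l) * g (l, j)) = - (kernel_matrix i0 y g $ i0 $ j - kernel_matrix i0 y' g' $ i0 $ j) - (\<Sum>l\<in>?J. y' l * (g (l, j) - g' (l, j)))"
      by (simp add: kernel_matrix_row algebra_simps sum_subtractf)
    moreover have "\<bar>\<Sum>l\<in>?J. y' l * (g (l, j) - g' (l, j))\<bar> \<le> (\<Sum>l\<in>?J. r)"
    proof (rule order_trans[OF sum_abs sum_mono])
      fix l assume l: "l \<in> ?J"
      then have "\<bar>y' l\<bar> \<le> 1" using y' by (simp add: sup_ball_def)
      then have "\<bar>y' l\<bar> * \<bar>g (l, j) - g' (l, j)\<bar> \<le> 1 * r" using gg[OF l, of j] by (intro mult_mono) auto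
      then show "\<bar>y' l * (g (l, j) - g' (l, j))\<bar> \<le> r" by (simp add: abs_mult)
    qed
    ultimately have up: "\<bar>\<Sum>l\<in>?J. (y l - y' l) * g (l, j)\<bar> \<le> r + (real CARD('m) - 1) * r"
      using r[of i0 j] cJ by simp
    have "(\<Sum>l\<in>?J. (y l - y' l) * g (l, j)) = (y l0 - y' l0) * g (l0, j) + (\<Sum>l\<in>?J - {l0}. (y l - y' l) * g (l, j))"
      using l0(1) by (intro sum.remove) auto
    moreover have "\<bar>\<Sum>l\<in>?J - {l0}. (y l - y' l) * g (l, j)\<bar> \<le> (\<Sum>l\<in>?J - {l0}. D * ?\<eta>)"
    proof (rule order_trans[OF sum_abs sum_mono])
      fix l assume l: "l \<in> ?J - {l0}"
      then have "j \<noteq> \<phi> l" using inj l0(1) by (auto simp: j_def inj_on_def)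
      then have "\<bar>g (l, j)\<bar> \<le> ?\<eta>" using near_centre_entries(1)[OF g, of l j] l by blast
      then show "\<bar>(y l - y' l) * g (l, j)\<bar> \<le> D * ?\<eta>"
        using D[of l] l unfolding abs_mult by (intro mult_mono) auto
    qed
    moreover have "D * (1 / 4 - ?\<eta>) \<le> \<bar>(y l0 - y' l0) * g (l0, j)\<bar>"
    proof -
      have "1 / 4 - ?\<eta> \<le> \<bar>g (l0, j)\<bar>" using near_centre_entries(2)[OF g l0(1)] by (simp add: j_def)
      then show ?thesis unfolding abs_mult l0(2) by (intro mult_left_mono) auto
    qed
    ultimately have "D * (1 / 4 - ?\<eta>) - real (card (?J - {l0})) * (D * ?\<eta>) \<le> real CARD('m) * r"
    proof -
      have up': "\<bar>\<Sum>l\<in>?J. (y l - y' l) * g (l, j)\<bar> \<le> real CARD('m) * r" using up by (simp add: algebra_simps)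
      assume eq: "(\<Sum>l\<in>?J. (y l - y' l) * g (l, j)) = (y l0 - y' l0) * g (l0, j) + (\<Sum>l\<in>?J - {l0}. (y l - y' l) * g (l, j))"
        and rest: "\<bar>\<Sum>l\<in>?J - {l0}. (y l - y' l) * g (l, j)\<bar> \<le> (\<Sum>l\<in>?J - {l0}. D * ?\<eta>)"
        and main: "D * (1 / 4 - ?\<eta>) \<le> \<bar>(y l0 - y' l0) * g (l0, j)\<bar>"
      show ?thesis using up' rest main unfolding eq by simp
    qed
    moreover have "D * (1 / 8) \<le> D * (1 / 4 - ?\<eta>) - real (card (?J - {l0})) * (D * ?\<eta>)"
    proof -
      have "real (Suc (card (?J - {l0}))) * ?\<eta> \<le> 1 / 8"
      proof (rule row_radius_bounds(2))
        have "Suc (card (?J - {l0})) = card ?J" using l0(1) by (intro card_Suc_Diff1) auto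
        also have "\<dots> \<le> CARD('m)" by (intro card_mono) auto
        finally show "Suc (card (?J - {l0})) \<le> CARD('m)" .
      qed
      then have "D * (real (Suc (card (?J - {l0}))) * ?\<eta>) \<le> D * (1 / 8)"
        using l0(2) by (intro mult_left_mono) auto
      then show ?thesis by (simp add: algebra_simps)
    qed
    ultimately have "D \<le> 8 * real CARD('m) * r" by linarith
    then show ?thesis using D unfolding sup_ball_def by force
  next
    case True
    then show ?thesis by (simp only: sup_ball_def ball_empty) simp
  qed
qed

lemma compact_coordinate_box:
  fixes c :: "'m::finite \<Rightarrow> real"
  shows "compact {v :: real ^ 'm. \<forall>i. \<bar>v $ i - c i\<bar> \<le> \<rho>}"
proof -
  have "{v :: real ^ 'm. \<forall>i. \<bar>v $ i - c i\<bar> \<le> \<rho>} = cbox (\<chi> i. c i - \<rho>) (\<chi> i. c i + \<rho>)"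
  proof (intro equalityI subsetI)
    fix v :: "real ^ 'm"
    have "\<bar>v $ i - c i\<bar> \<le> \<rho> \<longleftrightarrow> c i - \<rho> \<le> v $ i \<and> v $ i \<le> c i + \<rho>" for i by linarith
    then show "v \<in> {v. \<forall>i. \<bar>v $ i - c i\<bar> \<le> \<rho>} \<Longrightarrow> v \<in> cbox (\<chi> i. c i - \<rho>) (\<chi> i. c i + \<rho>)"
      and "v \<in> cbox (\<chi> i. c i - \<rho>) (\<chi> i. c i + \<rho>) \<Longrightarrow> v \<in> {v. \<forall>i. \<bar>v $ i - c i\<bar> \<le> \<rho>}"
      by (simp_all add: mem_box_cart)
  qed
  then show ?thesis by simp
qed

lemma compact_matrix_box:
  fixes c :: "'m::finite \<times> 'n::finite \<Rightarrow> real"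
  shows "compact {Z :: real ^ 'n ^ 'm. \<forall>i j. \<bar>Z $ i $ j - c (i, j)\<bar> \<le> \<rho>}" (is "compact ?B")
  unfolding compact_eq_bounded_closed
proof
  let ?C = "(\<chi> i j. c (i, j)) :: real ^ 'n ^ 'm"
  have "dist ?C Z \<le> real (CARD('m) * CARD('n)) * \<rho>" if "Z \<in> ?B" for Z
    using that norm_matrix_le[of "Z - ?C" \<rho>] by (simp add: dist_norm norm_minus_commute)
  then show "bounded ?B" unfolding bounded_def by blast
  show "closed ?B"
    by (intro closed_Collect_all closed_Collect_le continuous_intros)
qed

lemma compact_kernel_matrices:
  fixes i0 :: "'m::finite" and c :: "'m \<times> 'n::finite \<Rightarrow> real"
  assumes "0 \<le> \<delta>" "0 \<le> \<rho>"
  shows "compact {kernel_matrix i0 y g | y g. y \<in> sup_ball (UNIV - {i0}) p \<delta> \<and> g \<in> sup_ball ((UNIV - {i0}) \<times> UNIV) c \<rho>}"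
    (is "compact ?K")
proof -
  let ?h = "\<lambda>(v, Z). kernel_matrix i0 (($) v) (\<lambda>(i, j). Z $ i $ j)"
  let ?A = "{v :: real ^ 'm. \<forall>i. \<bar>v $ i - p i\<bar> \<le> \<delta>}" and ?B = "{Z :: real ^ 'n ^ 'm. \<forall>i j. \<bar>Z $ i $ j - c (i, j)\<bar> \<le> \<rho>}"
  have "continuous_on (?A \<times> ?B) ?h"
    unfolding kernel_matrix_def split_def
  proof (intro continuous_on_vec_lambda)
    fix i j
    show "continuous_on (?A \<times> ?B) (\<lambda>x. if i = i0 then - (\<Sum>l\<in>UNIV - {i0}. fst x $ l * snd x $ fst (l, j) $ snd (l, j))
        else snd x $ fst (i, j) $ snd (i, j))"
      by (cases "i = i0"; simp) (intro continuous_intros)+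
  qed
  then have "compact (?h ` (?A \<times> ?B))"
    by (intro compact_continuous_image compact_Times compact_coordinate_box compact_matrix_box)
  also have "?h ` (?A \<times> ?B) = ?K"
  proof (intro equalityI subsetI)
    fix X assume "X \<in> ?h ` (?A \<times> ?B)"
    then obtain v Z where "v \<in> ?A" "Z \<in> ?B" "X = kernel_matrix i0 (($) v) (\<lambda>(i, j). Z $ i $ j)" by auto
    moreover from this have "($) v \<in> sup_ball (UNIV - {i0}) p \<delta>" "(\<lambda>(i, j). Z $ i $ j) \<in> sup_ball ((UNIV - {i0}) \<times> UNIV) c \<rho>"
      by (auto simp: sup_ball_def)
    ultimately show "X \<in> ?K" by blast
  next
    fix X assume "X \<in> ?K"
    then obtain y g where yg: "y \<in> sup_ball (UNIV - {i0}) p \<delta>" "g \<in> sup_ball ((UNIV - {i0}) \<times> UNIV) c \<rho>" and X: "X = kernel_matrix i0 y g"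
      by blast
    define v :: "real ^ 'm" where "v = (\<chi> i. if i = i0 then p i else y i)"
    define Z :: "real ^ 'n ^ 'm" where "Z = (\<chi> i j. if i = i0 then c (i, j) else g (i, j))"
    have "v \<in> ?A" "Z \<in> ?B" using yg assms by (auto simp: v_def Z_def sup_ball_def)
    moreover have "X = ?h (v, Z)"
      unfolding X kernel_matrix_def v_def Z_def by (auto simp: vec_eq_iff intro!: sum.cong)
    ultimately show "X \<in> ?h ` (?A \<times> ?B)" by blast
  qed
  finally show ?thesis .
qed

text \<open>If the direction \<open>y\<close> is within \<open>\<delta>\<close> of \<open>p / q\<close>, then multiplying by \<open>q\<close> shows that \<open>w = (q, p)\<close> maps the matrix
to a combination of the free rows with coefficients of size at most \<open>q \<delta>\<close>, that is, at most
\<open>q powr (- \<tau>)\<close>; the column sums of the free rows are below \<open>1\<close>, which gives strict inequality.\<close>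

lemma kernel_matrix_near_rational_kernel:
  fixes i0 :: "'m::finite" and \<phi> :: "'m \<Rightarrow> 'n::finite" and p :: "'m \<Rightarrow> int"
  assumes inj: "inj_on \<phi> (UNIV - {i0})"
    and g: "g \<in> sup_ball ((UNIV - {i0}) \<times> UNIV) (row_centre \<phi>) (row_radius CARD('m))"
    and q: "0 < q" and x: "\<And>i. i \<noteq> i0 \<Longrightarrow> x i = real_of_int (p i) / real q"
    and y: "y \<in> sup_ball (UNIV - {i0}) x \<delta>" and \<delta>: "\<delta> \<le> real q powr (- (\<tau> + 1))"
    and x1: "x \<in> sup_ball (UNIV - {i0}) (\<lambda>_. 0) 1"
  defines "w \<equiv> (\<chi> i. if i = i0 then int q else p i)"
  shows "w \<in> int_shell q" "infnorm (int_vec w v* kernel_matrix i0 y g) < infnorm (int_vec w) powr (- \<tau>)"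
proof -
  let ?J = "UNIV - {i0}"
  have q0: "0 < real q" using q by simp
  show w: "w \<in> int_shell q"
  proof -
    have "\<bar>w $ i\<bar> \<le> int q" for i
    proof (cases "i = i0")
      case False
      then have "\<bar>x i\<bar> \<le> 1" using x1 by (simp add: sup_ball_def)
      then have "\<bar>real_of_int (p i)\<bar> \<le> real q" using q0 unfolding x[OF False] by (simp add: abs_divide)
      then have "\<bar>p i\<bar> \<le> int q" by linarith
      then show ?thesis using False by (simp add: w_def)
    qed (simp add: w_def)
    moreover have "\<bar>w $ i0\<bar> = int q" by (simp add: w_def)
    ultimately show ?thesis by (auto simp: int_shell_def)
  qed
  have entry: "\<bar>(int_vec w v* kernel_matrix i0 y g) $ j\<bar> \<le> 3 / 8 * real q powr (- \<tau>)" for j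
  proof -
    have "(int_vec w v* kernel_matrix i0 y g) $ j
        = real q * kernel_matrix i0 y g $ i0 $ j + (\<Sum>l\<in>?J. real_of_int (w $ l) * kernel_matrix i0 y g $ l $ j)"
      unfolding int_vec_matrix_mult by (subst sum.remove[of _ i0]) (auto simp: w_def)
    also have "(\<Sum>l\<in>?J. real_of_int (w $ l) * kernel_matrix i0 y g $ l $ j) = (\<Sum>l\<in>?J. real q * x l * g (l, j))"
      using q0 by (intro sum.cong) (auto simp: w_def x kernel_matrix_other)
    also have "real q * kernel_matrix i0 y g $ i0 $ j + \<dots> = (\<Sum>l\<in>?J. real q * (x l - y l) * g (l, j))"
      by (simp add: kernel_matrix_row sum_distrib_left algebra_simps sum_subtractf)
    also have "\<bar>\<dots>\<bar> \<le> (\<Sum>l\<in>?J. real q powr (- \<tau>) * \<bar>g (l, j)\<bar>)"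
    proof (rule order_trans[OF sum_abs sum_mono])
      fix l assume "l \<in> ?J"
      then have "\<bar>x l - y l\<bar> \<le> \<delta>" using y by (simp add: sup_ball_def abs_minus_commute)
      then have "real q * \<bar>x l - y l\<bar> \<le> real q powr 1 * real q powr (- (\<tau> + 1))"
        using \<delta> q0 by (intro mult_mono) auto
      also have "\<dots> = real q powr (- \<tau>)" unfolding powr_add[symmetric] by simp
      finally show "\<bar>real q * (x l - y l) * g (l, j)\<bar> \<le> real q powr (- \<tau>) * \<bar>g (l, j)\<bar>"
        by (simp add: abs_mult mult_right_mono)
    qed
    also have "\<dots> = real q powr (- \<tau>) * (\<Sum>l\<in>?J. \<bar>g (l, j)\<bar>)" by (simp add: sum_distrib_left)
    also have "\<dots> \<le> real q powr (- \<tau>) * (3 / 8)"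
      by (intro mult_left_mono column_sum_le[OF inj g]) simp
    finally show ?thesis by simp
  qed
  have "infnorm (int_vec w v* kernel_matrix i0 y g) \<le> 3 / 8 * real q powr (- \<tau>)"
    unfolding infnorm_cart by (rule cSup_least) (use entry in auto)
  also have "\<dots> < real q powr (- \<tau>)" using q0 by simp
  finally show "infnorm (int_vec w v* kernel_matrix i0 y g) < infnorm (int_vec w) powr (- \<tau>)"
    using infnorm_int_shell[OF w] by simp
qed

section \<open>Lower bounds and the dimension\<close>

text \<open>The stages of the Cantor set in \<open>m - 1\<close> dimensions, with exponent \<open>s < m / (\<tau> + 1)\<close>, and grids in the
\<open>(m - 1) n\<close> entries of the free rows are transported to matrices. By the Lipschitz inverse a set of diameter
\<open>r\<close> only involves directions and rows from cubes of radius comparable to \<open>r\<close>, so the mass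
exponent of the product is \<open>s + (m - 1) n\<close>.\<close>

lemma W0_Hausdorff_measure_nonzero:
  fixes \<tau> t :: real
  assumes mn: "2 \<le> CARD('m::finite)" "CARD('m) \<le> CARD('n::finite)"
    and \<tau>: "1 / (real CARD('m) - 1) < \<tau>"
    and t: "0 \<le> t" "t < (real CARD('m) - 1) * real CARD('n) + real CARD('m) / (\<tau> + 1)"
  shows "hausdorff_measure t (W0 \<tau> :: (real ^ 'n ^ 'm) set) \<noteq> 0"
proof -
  define i0 :: 'm where "i0 = undefined"
  let ?J = "UNIV - {i0}"
  let ?D = "?J \<times> (UNIV :: 'n set)"
  have cJ: "card ?J = CARD('m) - 1" "real (card ?J) = real CARD('m) - 1"
    by (simp_all add: card_Diff_singleton of_nat_diff Suc_leI)
  have Jne: "?J \<noteq> {}" using cJ(1) mn(1) by (metis card.empty diff_is_0_eq not_less_eq_eq numeral_2_eq_2 One_nat_def)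
  have "card ?J \<le> CARD('n)" using cJ(1) mn(2) by linarith
  then obtain \<phi> :: "'m \<Rightarrow> 'n" where inj: "inj_on \<phi> ?J"
    using card_le_inj[of ?J "UNIV :: 'n set"] by auto
  define e where "e = (real CARD('m) - 1) * real CARD('n)"
  have cD: "real (card ?D) = e" by (simp add: card_cartesian_product cJ(2) e_def)
  have \<tau>0: "0 < \<tau>" using \<tau> mn(1) by (intro less_trans[OF _ \<tau>]) simp
  have "max 0 (t - e) < real CARD('m) / (\<tau> + 1)" using t \<tau>0 by (simp add: e_def)
  then obtain s where s: "0 < s" "t - e < s" "s < real CARD('m) / (\<tau> + 1)"
    using dense[of "max 0 (t - e)"] by auto
  have e0: "0 \<le> e" using cD by (metis of_nat_0_le_iff)
  have J: "finite ?J" "1 / real (card ?J) < \<tau>" "s < (real (card ?J) + 1) / (\<tau> + 1)" using \<tau> s(3) by (simp_all add: cJ(2))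
  obtain P :: "nat \<Rightarrow> ('m \<Rightarrow> real) set" and \<delta> :: "nat \<Rightarrow> real" and C :: real
    where P0: "P 0 = {\<lambda>_. 0}" "\<delta> 0 = 1" and \<delta>: "\<And>k. 0 < \<delta> k" "\<And>k. \<delta> (Suc k) \<le> \<delta> k / 2"
    and P: "\<And>k. finite (P k)" "\<And>k. P k \<noteq> {}" "\<And>k. separated ?J (\<delta> k) (P k)"
    and nest: "\<And>k y. y \<in> P (Suc k) \<Longrightarrow> \<exists>x\<in>P k. y \<in> sup_ball ?J x (\<delta> k / 2)"
    and rat: "\<And>k y. y \<in> P (Suc k) \<Longrightarrow> \<exists>(q::nat) (p::'m \<Rightarrow> int). k < q \<and> \<delta> (Suc k) \<le> real q powr (- (\<tau> + 1)) \<and> (\<forall>i\<in>?J. y i = real_of_int (p i) / real q)"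
    and C: "0 < C" and count: "\<And>k c r. \<delta> k \<le> r \<Longrightarrow> real (card (P k \<inter> sup_ball ?J c r)) \<le> C * r powr s * real (card (P k))"
    by (rule Cantor_set_of_well_approximable_points[OF J(1) Jne J(2) s(1) J(3)]) blast
  define \<eta> where "\<eta> = row_radius CARD('m)"
  have \<eta>: "0 < \<eta>" unfolding \<eta>_def by (rule row_radius_bounds(1)[OF order_refl])
  let ?B = "sup_ball ?D (row_centre \<phi>) \<eta>"
  define V where "V k = (\<Union>x\<in>P k. sup_ball ?J x (\<delta> k))" for k
  define K where "K k = {kernel_matrix i0 y g | y g. y \<in> V k \<and> g \<in> ?B}" for k
  have V_dec: "V (Suc k) \<subseteq> V k" for k
  proof
    fix y assume "y \<in> V (Suc k)"
    then obtain x' where x': "x' \<in> P (Suc k)" "y \<in> sup_ball ?J x' (\<delta> (Suc k))" by (auto simp: V_def)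
    obtain x where x: "x \<in> P k" "x' \<in> sup_ball ?J x (\<delta> k / 2)" using nest[OF x'(1)] by blast
    have "y \<in> sup_ball ?J x (\<delta> (Suc k) + \<delta> k / 2)" using x'(2) x(2) by (rule sup_ball_triangle)
    moreover have "sup_ball ?J x (\<delta> (Suc k) + \<delta> k / 2) \<subseteq> sup_ball ?J x (\<delta> k)" using \<delta>(2)[of k] by (intro sup_ball_mono) simp
    ultimately show "y \<in> V k" using x(1) by (auto simp: V_def)
  qed
  have V1: "V k \<subseteq> sup_ball ?J (\<lambda>_. 0) 1" for k
  proof (induction k)
    case (Suc k)
    then show ?case using V_dec by blast
  qed (simp add: V_def P0)
  have PV: "P k \<subseteq> V k" for k using \<delta>(1)[of k] by (force simp: V_def sup_ball_def)
  have compact_K: "compact (K k)" for k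
  proof -
    have "K k = (\<Union>x\<in>P k. {kernel_matrix i0 y g | y g. y \<in> sup_ball ?J x (\<delta> k) \<and> g \<in> ?B})"
      unfolding K_def V_def by blast
    then show ?thesis using P(1) \<delta>(1)[of k] \<eta> by (auto intro!: compact_UN compact_kernel_matrices)
  qed
  have K_dec: "K (Suc k) \<subseteq> K k" for k using V_dec unfolding K_def by blast
  have K_W0: "(\<Inter>k. K k) \<subseteq> W0 \<tau>"
  proof
    fix X assume X: "X \<in> (\<Inter>k. K k)"
    let ?Q = "{q :: int ^ 'm. q \<noteq> 0 \<and> infnorm (int_vec q v* X) < infnorm (int_vec q) powr (- \<tau>)}"
    have large: "\<exists>w\<in>?Q. real k < infnorm (int_vec w)" for k
    proof -
      have "X \<in> K (Suc k)" using X by blast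
      then obtain y g where yg: "y \<in> V (Suc k)" "g \<in> ?B" and X_eq: "X = kernel_matrix i0 y g"
        unfolding K_def by blast
      then obtain x where x: "x \<in> P (Suc k)" "y \<in> sup_ball ?J x (\<delta> (Suc k))" by (auto simp: V_def)
      obtain q :: nat and p :: "'m \<Rightarrow> int" where q: "k < q" "\<delta> (Suc k) \<le> real q powr (- (\<tau> + 1))"
        and p: "\<forall>i\<in>?J. x i = real_of_int (p i) / real q" using rat[OF x(1)] by blast
      let ?w = "(\<chi> i. if i = i0 then int q else p i) :: int ^ 'm"
      have "x \<in> sup_ball ?J (\<lambda>_. 0) 1" using x(1) PV V1 by blast
      then have w: "?w \<in> int_shell q" "infnorm (int_vec ?w v* X) < infnorm (int_vec ?w) powr (- \<tau>)"
        using kernel_matrix_near_rational_kernel[OF inj yg(2)[unfolded \<eta>_def], of q x p y "\<delta> (Suc k)" \<tau>] p q x(2) X_eq by auto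
      have "?w $ i0 \<noteq> 0" using q(1) by simp
      then have "?w \<noteq> 0" by (metis zero_index)
      then have "?w \<in> ?Q" using w(2) by blast
      moreover have "real k < infnorm (int_vec ?w)" using infnorm_int_shell[OF w(1)] q(1) by simp
      ultimately show ?thesis by blast
    qed
    have "infinite ?Q"
    proof
      assume fin: "finite ?Q"
      obtain k :: nat where k: "Max ((\<lambda>w. infnorm (int_vec w)) ` ?Q) \<le> real k" using real_arch_simple by blast
      obtain w where w: "w \<in> ?Q" "real k < infnorm (int_vec w)" using large by blast
      have "infnorm (int_vec w) \<le> Max ((\<lambda>w. infnorm (int_vec w)) ` ?Q)" using fin w(1) by (intro Max_ge) auto
      then show False using k w(2) by linarith
    qed
    moreover have "X \<in> unit_cube_matrices"
    proof -
      have "X \<in> K 0" using X by blast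
      then obtain y g where "y \<in> V 0" "g \<in> ?B" "X = kernel_matrix i0 y g" unfolding K_def by blast
      then show ?thesis using kernel_matrix_in_unit_cube[OF inj, of y g] V1[of 0] by (auto simp: \<eta>_def)
    qed
    ultimately show "X \<in> W0 \<tau>" by (simp add: W0_def)
  qed
  have "\<exists>M::nat. 0 < M \<and> \<eta> / real M \<le> \<delta> k" for k
  proof -
    obtain M :: nat where M: "\<eta> / \<delta> k < real M" using reals_Archimedean2 by blast
    moreover have "0 < \<eta> / \<delta> k" using \<eta> \<delta>(1) by simp
    ultimately have "0 < real M" by linarith
    then show ?thesis using M \<delta>(1)[of k] by (intro exI[of _ M]) (simp add: field_simps)
  qed
  then obtain M :: "nat \<Rightarrow> nat" where M: "\<And>k. 0 < M k" "\<And>k. \<eta> / real (M k) \<le> \<delta> k" by metis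
  define G where "G k = grid ?D (row_centre \<phi>) (\<eta> / real (M k)) (M k)" for k
  have h0: "0 < \<eta> / real (M k)" for k using \<eta> M(1)[of k] by simp
  have finD: "finite ?D" by simp
  have finG: "finite (G k)" and sepG: "separated ?D (\<eta> / real (M k)) (G k)" and cardG: "card (G k) = M k ^ card ?D" for k
    unfolding G_def by (rule finite_grid[OF finD] separated_grid[OF h0] card_grid[OF finD h0])+
  have GB: "G k \<subseteq> ?B" for k
  proof
    fix g assume g: "g \<in> G k"
    have "\<bar>g ij - row_centre \<phi> ij\<bar> \<le> \<eta>" if "ij \<in> ?D" for ij
      using grid_bounds[OF g[unfolded G_def] that h0] M(1)[of k] by simp
    then show "g \<in> ?B" by (simp add: sup_ball_def)
  qed
  let ?\<Phi> = "\<lambda>(x, g). kernel_matrix i0 x g"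
  define S where "S k = ?\<Phi> ` (P k \<times> G k)" for k
  let ?c = "8 * real CARD('m)"
  have c1: "1 \<le> ?c" using mn(1) by simp
  have close: "x \<in> sup_ball ?J x' (?c * r) \<and> g \<in> sup_ball ?D g' r"
    if xg: "x' \<in> P k" "g \<in> G k" and d: "dist (kernel_matrix i0 x g) (kernel_matrix i0 x' g') \<le> r" for x x' g g' k r
  proof -
    have "\<bar>kernel_matrix i0 x g $ i $ j - kernel_matrix i0 x' g' $ i $ j\<bar> \<le> r" for i j
    proof -
      have "\<bar>(kernel_matrix i0 x g - kernel_matrix i0 x' g') $ i $ j\<bar> \<le> norm ((kernel_matrix i0 x g - kernel_matrix i0 x' g') $ i)"
        by (rule component_le_norm_cart)
      also have "\<dots> \<le> norm (kernel_matrix i0 x g - kernel_matrix i0 x' g')" by (rule Finite_Cartesian_Product.norm_nth_le)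
      finally show ?thesis using d by (simp add: dist_norm)
    qed
    then show ?thesis
      using kernel_matrix_inverse_Lipschitz[OF inj, of x' g x g' r] xg PV[of k] V1[of k] GB[of k] unfolding \<eta>_def by blast
  qed
  have inj_\<Phi>: "inj_on ?\<Phi> (P k \<times> G k)" for k
  proof (rule inj_onI, clarify)
    fix x g x' g' assume x: "x \<in> P k" "x' \<in> P k" and g: "g \<in> G k" "g' \<in> G k" and eq: "kernel_matrix i0 x g = kernel_matrix i0 x' g'"
    have "x \<in> sup_ball ?J x' (?c * 0) \<and> g \<in> sup_ball ?D g' 0" using close[OF x(2) g(1), of x g' 0] eq by simp
    then have "\<And>i. i \<in> ?J \<Longrightarrow> x i = x' i" "\<And>ij. ij \<in> ?D \<Longrightarrow> g ij = g' ij" by (auto simp: sup_ball_def)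
    then show "x = x' \<and> g = g'"
      using P(3)[of k] sepG[of k] x g \<delta>(1)[of k] h0[of k] unfolding separated_def by (metis abs_zero cancel_comm_monoid_add_class.diff_cancel not_le)
  qed
  have cardS: "real (card (S k)) = real (card (P k)) * real (M k) ^ card ?D" for k
    unfolding S_def card_image[OF inj_\<Phi>] by (simp add: card_cartesian_product cardG)
  define C' where "C' = C * ?c powr s * (3 / \<eta>) ^ card ?D"
  have countS: "real (card U) \<le> C' * r powr (s + e) * real (card (S k))"
    if U: "U \<subseteq> S k" and r: "\<delta> k \<le> r" "0 < r" and diam: "\<And>X Y. X \<in> U \<Longrightarrow> Y \<in> U \<Longrightarrow> dist X Y \<le> r" for k U r
  proof (cases "U = {}")
    case True
    then show ?thesis using C \<eta> by (simp add: C'_def)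
  next
    case False
    then obtain x0 g0 where xg0: "x0 \<in> P k" "g0 \<in> G k" "kernel_matrix i0 x0 g0 \<in> U" using U by (fastforce simp: S_def)
    let ?P = "P k \<inter> sup_ball ?J x0 (?c * r)" and ?G = "G k \<inter> sup_ball ?D g0 r"
    have "U \<subseteq> ?\<Phi> ` (?P \<times> ?G)"
    proof
      fix X assume X: "X \<in> U"
      then obtain x g where xg: "x \<in> P k" "g \<in> G k" "X = kernel_matrix i0 x g" using U by (fastforce simp: S_def)
      then have "x \<in> sup_ball ?J x0 (?c * r) \<and> g \<in> sup_ball ?D g0 r"
        using close[OF xg0(1) xg(2), of x g0 r] diam[OF X xg0(3)] by blast
      then show "X \<in> ?\<Phi> ` (?P \<times> ?G)" using xg by auto
    qed
    then have "card U \<le> card ?P * card ?G"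
      using P(1)[of k] finG[of k] by (metis card_cartesian_product finite_Int finite_SigmaI surj_card_le)
    then have "real (card U) \<le> real (card ?P) * real (card ?G)" by (metis of_nat_le_iff of_nat_mult)
    also have "\<dots> \<le> (C * (?c * r) powr s * real (card (P k))) * (3 * r * real (M k) / \<eta>) ^ card ?D"
    proof (intro mult_mono)
      have "1 * r \<le> ?c * r" using c1 r(2) by (intro mult_right_mono) auto
      then show "real (card ?P) \<le> C * (?c * r) powr s * real (card (P k))" using r(1) by (intro count) simp
      have "separated ?D (\<eta> / real (M k)) ?G" using sepG by (rule separated_subset) simp
      then have "real (card ?G) \<le> (2 * r / (\<eta> / real (M k)) + 1) ^ card ?D"
        using r(2) by (intro card_separated_le(2)[OF finD h0, of r _ g0]) auto
      also have "\<dots> \<le> (3 * r * real (M k) / \<eta>) ^ card ?D"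
      proof (rule power_mono)
        have "\<eta> / real (M k) \<le> r" using M(2)[of k] r(1) by linarith
        then have "1 \<le> r * real (M k) / \<eta>" using \<eta> M(1)[of k] by (simp add: field_simps)
        then show "2 * r / (\<eta> / real (M k)) + 1 \<le> 3 * r * real (M k) / \<eta>" by simp
        have "0 \<le> 2 * r / (\<eta> / real (M k))" using r(2) h0[of k] by (intro divide_nonneg_pos) auto
        then show "0 \<le> 2 * r / (\<eta> / real (M k)) + 1" by linarith
      qed
      finally show "real (card ?G) \<le> (3 * r * real (M k) / \<eta>) ^ card ?D" .
    qed (use C in auto)
    also have "\<dots> = C' * r powr (s + e) * real (card (S k))"
    proof -
      have "r ^ card ?D = r powr e" using r(2) cD powr_realpow[OF r(2), of "card ?D"] by simp
      moreover have "(3 * r * real (M k) / \<eta>) ^ card ?D = (3 / \<eta>) ^ card ?D * r ^ card ?D * real (M k) ^ card ?D"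
        by (simp flip: power_mult_distrib)
      moreover have "(?c * r) powr s = ?c powr s * r powr s" using r(2) by (intro powr_mult)
      ultimately show ?thesis by (simp only: C'_def cardS powr_add mult.assoc mult.commute mult.left_commute)
    qed
    finally show ?thesis .
  qed
  have "\<delta> \<longlonglongrightarrow> 0"
  proof (rule tendsto_sandwich[OF _ _ tendsto_const])
    have "\<delta> k \<le> (1 / 2) ^ k" for k
    proof (induction k)
      case (Suc k)
      then show ?case using \<delta>(2)[of k] by simp
    qed (simp add: P0)
    then show "eventually (\<lambda>k. \<delta> k \<le> (1 / 2) ^ k) sequentially" by simp
    show "eventually (\<lambda>k. 0 \<le> \<delta> k) sequentially" using \<delta>(1) less_imp_le by (intro always_eventually) blast
    show "(\<lambda>k. (1 / 2) ^ k) \<longlonglongrightarrow> (0::real)" by (rule LIMSEQ_power_zero) simp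
  qed
  moreover have "S k \<subseteq> K k" for k using PV GB unfolding S_def K_def by fastforce
  moreover have "finite (S k)" "S k \<noteq> {}" for k
  proof -
    show "finite (S k)" using P(1) finG by (simp add: S_def)
    have "card (G k) \<noteq> 0" using cardG M(1)[of k] by simp
    then have "G k \<noteq> {}" by force
    then show "S k \<noteq> {}" using P(2) by (simp add: S_def)
  qed
  moreover have "0 < C'" using C c1 \<eta> by (simp add: C'_def)
  ultimately have "hausdorff_measure t (\<Inter>k. K k) \<noteq> 0"
    using t(1) s(1,2) e0
    by (intro hausdorff_measure_nonzero_if_discrete_mass[of K S \<delta> t "s + e" C', OF compact_K K_dec _ _ _ _ _ _ _ _ countS]) auto
  then show ?thesis using hausdorff_measure_zero_subset[OF _ K_W0] by blast
qed

lemma W0_antimono: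
  assumes "\<tau> \<le> \<tau>'"
  shows "W0 \<tau>' \<subseteq> (W0 \<tau> :: (real ^ 'n::finite ^ 'm::finite) set)"
proof
  fix X :: "real ^ 'n ^ 'm" assume X: "X \<in> W0 \<tau>'"
  let ?Q = "\<lambda>\<tau>. {q :: int ^ 'm. q \<noteq> 0 \<and> infnorm (int_vec q v* X) < infnorm (int_vec q) powr (- \<tau>)}"
  have "?Q \<tau>' \<subseteq> ?Q \<tau>"
  proof
    fix q :: "int ^ 'm" assume q: "q \<in> ?Q \<tau>'"
    obtain N where N: "q \<in> int_shell N" using int_shell_exists by blast
    have "N \<noteq> 0"
    proof
      assume "N = 0"
      then have "q = 0" using N by (simp add: int_shell_def vec_eq_iff)
      then show False using q by simp
    qed
    then have "real N powr (- \<tau>') \<le> real N powr (- \<tau>)" using assms by (intro powr_mono) auto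
    then show "q \<in> ?Q \<tau>" using q infnorm_int_shell[OF N] by auto
  qed
  then show "X \<in> W0 \<tau>" using X infinite_super unfolding W0_def by blast
qed

theorem corollary6:
  fixes \<tau> :: real
  assumes "2 \<le> CARD('m::finite)" and "CARD('m) \<le> CARD('n::finite)"
  defines "m \<equiv> real CARD('m)" and "n \<equiv> real CARD('n)"
  shows "(\<tau> > m / (m - 1) - 1 \<longrightarrow>
            hausdorff_dim (W0 \<tau> :: (real ^ 'n ^ 'm) set) = ereal ((m - 1) * n + m / (\<tau> + 1))) \<and>
         (0 < \<tau> \<and> \<tau> \<le> m / (m - 1) - 1 \<longrightarrow>
            hausdorff_dim (W0 \<tau> :: (real ^ 'n ^ 'm) set) = ereal ((m - 1) * (n + 1)))"
proof (intro conjI impI)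
  have m: "2 \<le> m" using assms(1) by (simp add: m_def)
  have n: "0 \<le> n" by (simp add: n_def)
  have threshold: "m / (m - 1) - 1 = 1 / (m - 1)" using m by (simp add: field_simps)
  {
    assume "\<tau> > m / (m - 1) - 1"
    then have \<tau>: "1 / (m - 1) < \<tau>" by (simp only: threshold)
    have "0 < 1 / (m - 1)" using m by simp
    then have \<tau>0: "0 < \<tau>" using \<tau> by linarith
    show "hausdorff_dim (W0 \<tau> :: (real ^ 'n ^ 'm) set) = ereal ((m - 1) * n + m / (\<tau> + 1))"
    proof (rule hausdorff_dim_eqI)
      show "0 \<le> (m - 1) * n + m / (\<tau> + 1)" using m n \<tau>0 by simp
      show "hausdorff_measure s (W0 \<tau> :: (real ^ 'n ^ 'm) set) = 0" if "s > (m - 1) * n + m / (\<tau> + 1)" for s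
        using that \<tau>0 unfolding m_def n_def by (intro W0_null_by_shell_series)
      show "hausdorff_measure s (W0 \<tau> :: (real ^ 'n ^ 'm) set) \<noteq> 0" if "0 \<le> s" "s < (m - 1) * n + m / (\<tau> + 1)" for s
        using that \<tau> assms(1,2) unfolding m_def n_def by (intro W0_Hausdorff_measure_nonzero)
    qed
  }
  assume "0 < \<tau> \<and> \<tau> \<le> m / (m - 1) - 1"
  then have \<tau>: "0 < \<tau>" "\<tau> \<le> 1 / (m - 1)" by (simp_all only: threshold)
  show "hausdorff_dim (W0 \<tau> :: (real ^ 'n ^ 'm) set) = ereal ((m - 1) * (n + 1))"
  proof (rule hausdorff_dim_eqI)
    show "0 \<le> (m - 1) * (n + 1)" using m n by simp
    show "hausdorff_measure s (W0 \<tau> :: (real ^ 'n ^ 'm) set) = 0" if "s > (m - 1) * (n + 1)" for s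
      using that \<tau>(1) unfolding m_def n_def by (intro W0_null_by_single_shell)
    show "hausdorff_measure s (W0 \<tau> :: (real ^ 'n ^ 'm) set) \<noteq> 0" if s: "0 \<le> s" "s < (m - 1) * (n + 1)" for s
    proof -
      have "((\<lambda>\<tau>'. (m - 1) * n + m / (\<tau>' + 1)) \<longlongrightarrow> (m - 1) * n + m / (1 / (m - 1) + 1)) (at_right (1 / (m - 1)))"
        using m by (intro tendsto_intros) (simp add: field_simps)
      also have "(m - 1) * n + m / (1 / (m - 1) + 1) = (m - 1) * (n + 1)"
        using m by (simp add: field_simps)
      finally have "eventually (\<lambda>\<tau>'. s < (m - 1) * n + m / (\<tau>' + 1)) (at_right (1 / (m - 1)))"
        using s(2) by (rule order_tendstoD)
      moreover have "eventually (\<lambda>\<tau>'. 1 / (m - 1) < \<tau>') (at_right (1 / (m - 1)))"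
        by (rule eventually_at_right_less)
      ultimately have "eventually (\<lambda>\<tau>'. s < (m - 1) * n + m / (\<tau>' + 1) \<and> 1 / (m - 1) < \<tau>') (at_right (1 / (m - 1)))"
        by (rule eventually_conj)
      then obtain \<tau>' where \<tau>': "s < (m - 1) * n + m / (\<tau>' + 1)" "1 / (m - 1) < \<tau>'"
        using eventually_happens' trivial_limit_at_right_real by blast
      have "hausdorff_measure s (W0 \<tau>' :: (real ^ 'n ^ 'm) set) \<noteq> 0"
        using s(1) \<tau>' assms(1,2) unfolding m_def n_def by (intro W0_Hausdorff_measure_nonzero)
      then show ?thesis
        using hausdorff_measure_zero_subset[OF _ W0_antimono[of \<tau> \<tau>']] \<tau>(2) \<tau>'(2) by fastforce
    qed
  qed
qed

end
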